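(* Let $K\subset\mathbb{R}^3$ be the regular tetrahedron with vertices $(1,0,0)$, $(0,1,0)$, $(0,0,1)$, $(1,1,1)$ (of volume $1/3$), and let $X,Y$ be independent random points uniformly distributed in $K$. Then $$\mathbb{E}\,\|X-Y\| = \frac{\sqrt{2}}{7}-\frac{37 \pi }{315}+\frac{4}{15} \arctan \sqrt{2}+\frac{113 \ln 3}{210 \sqrt{2}}.$$ Consequently, for a regular tetrahedron of unit volume, the mean distance between two independent uniform random points equals $$\sqrt[3]{3}\left(\frac{\sqrt{2}}{7}-\frac{37 \pi }{315}+\frac{4}{15} \arctan \sqrt{2}+\frac{113 \ln 3}{210 \sqrt{2}}\right).$$
   Context: $\|\cdot\|$ is the Euclidean norm; "tetrahedron" means the solid body (convex hull of its vertices). *)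

theory Defs
  imports "HOL-Probability.Probability"
begin

(* A solid tetrahedron is regular if its six edges have the same length.  Affine
   independence of the vertices is not assumed, because four distinct points with equal
   pairwise distances are always affinely independent. *)
definition regular_tetrahedron :: "(real^3) set \<Rightarrow> bool" where
  "regular_tetrahedron T \<longleftrightarrow>
     (\<exists>V s. card V = 4 \<and> pairwise (\<lambda>v w. dist v w = s) V \<and> T = convex hull V)"

definition K_tetrahedron :: "(real^3) set" where
  "K_tetrahedron =
     convex hull {vector [1, 0, 0], vector [0, 1, 0], vector [0, 0, 1], vector [1, 1, 1]}"

definition uniformly_distributed_in ::
    "'w measure \<Rightarrow> ('w \<Rightarrow> real^3) \<Rightarrow> (real^3) set \<Rightarrow> bool" where
  "uniformly_distributed_in M X T \<longleftrightarrow>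
     X \<in> measurable M borel \<and> distr M borel X = uniform_measure lborel T"

definition independent_uniform_points ::
    "'w measure \<Rightarrow> ('w \<Rightarrow> real^3) \<Rightarrow> ('w \<Rightarrow> real^3) \<Rightarrow> (real^3) set \<Rightarrow> bool" where
  "independent_uniform_points M X Y T \<longleftrightarrow>
     prob_space M \<and> prob_space.indep_var M borel X borel Y \<and>
     uniformly_distributed_in M X T \<and> uniformly_distributed_in M Y T"

end

(* By translation invariance the mean distance is the integral of |z| |K \<inter> (K - z)| over z,
   divided by |K|^2.  Since K is a simplex, K \<inter> (K - z) is a homothetic copy of K of ratio
   1 - \<rho>(z), where \<rho> is the norm with unit ball K - K, a cuboctahedron.  The resulting integral of
   |z| (1 - \<rho>(z))^3 is invariant under the 48 symmetries of the cube.  The fundamental chamber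
   x \<ge> y \<ge> z \<ge> 0 splits into a cone over a piece of a square face and a cone over a piece of a
   triangular face; in suitable orthogonal coordinates both are {0 \<le> r \<le> q \<le> p} with \<rho> = p, and
   each contributes one elementary integral in one variable. *)
theory Submission
  imports Defs
begin

section \<open>Affine changes of variables\<close>

text \<open>The coordinates of each cone come from a right-angled flag of a face: face centre, edge
  midpoint, vertex. The chart has as columns the centre and the two successive differences, which
  are mutually orthogonal, with squared lengths 1, 1/2, 1/2 for the square and 4/3, 1/6, 1/2 for the
  triangle. Both pieces end in the same half edge from (1, 1/2, 1/2) to (1, 1, 0), and |(1, 1/2,
  1/2)|^2 = 3/2, so a single root sqrt (3 + w^2) occurs in both integrals; they differ only in the
  denominators 1 + w^2 and 1 + 3 w^2, which produce the arctangents. Since norm and gauge are both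
  homogeneous of degree 1, the radial integral splits off as the Beta value B(4,4) = 1/140. A
  similarity of ratio c multiplies the mean by c^7 / (c^3)^2 = c, so all regular tetrahedra reduce
  to K. Integrals stay in \<open>ennreal\<close>, where Fubini and substitution ask only for
  measurability; the price is that the two closed forms must be shown nonnegative before returning
  to the reals.\<close>

lemma nn_integral_lborel_affine:
  fixes A :: "real^3^3" and f :: "real^3 \<Rightarrow> ennreal"
  assumes [measurable]: "f \<in> borel_measurable borel" and det: "det A \<noteq> 0"
  shows "(\<integral>\<^sup>+x. f x \<partial>lborel) = \<bar>det A\<bar> * (\<integral>\<^sup>+x. f (a + A *v x) \<partial>lborel)"
proof -
  define T where "T = (\<lambda>x. a + A *v x)"
  have T_cont: "continuous_on UNIV T"
    unfolding T_def by (intro continuous_intros linear_continuous_on matrix_vector_mul_linear)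
       (simp add: linear_linear)
  then have [measurable]: "T \<in> borel_measurable borel"
    by (rule borel_measurable_continuous_onI)
  obtain B where AB: "A ** B = mat 1" and BA: "B ** A = mat 1"
    using det invertible_det_nz invertible_def by blast
  \<comment> \<open>Lebesgue measure is determined by its values on boxes. The preimage of a box
    under the affine map is open and bounded, so its volume is governed by
    \<open>measure_linear_image\<close>.\<close>
  have "lborel = density (distr lborel borel T) (\<lambda>_. ennreal \<bar>det A\<bar>)"
  proof (rule lborel_eqI)
    fix l u :: "real^3"
    assume le: "\<And>b. b \<in> Basis \<Longrightarrow> l \<bullet> b \<le> u \<bullet> b"
    define S where "S = T -` box l u"
    have S_eq: "S = (\<lambda>x. B *v (x - a)) ` box l u"
    proof -
      have "B *v (T x - a) = x" "T (B *v (x - a)) = x" for x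
        by (simp_all add: T_def matrix_vector_mul_assoc AB BA)
      then show ?thesis
        unfolding S_def by (auto simp: image_iff) metis
    qed
    have "bounded ((\<lambda>x. B *v x) ` ((\<lambda>x. x - a) ` box l u))"
      by (intro bounded_linear_image bounded_translation_minus bounded_box)
         (simp add: linear_linear)
    then have "bounded S"
      by (simp add: S_eq image_image)
    have "open S"
      unfolding S_def by (rule open_vimage[OF open_box T_cont])
    have S_meas: "S \<in> lmeasurable"
      using \<open>bounded S\<close> \<open>open S\<close> by (rule lmeasurable_open)
    have img: "box l u = (+) a ` ((*v) A ` S)"
    proof -
      have "T ` S = box l u"
        unfolding S_def T_def using AB
        by (auto simp: image_iff intro!: bexI[of _ "B *v (_ - a)"])
           (metis AB add.commute diff_add_cancel matrix_vector_mul_assoc matrix_vector_mul_lid)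
      then show ?thesis by (auto simp: T_def image_image)
    qed
    have "measure lebesgue (box l u) = \<bar>det A\<bar> * measure lebesgue S"
      unfolding img measure_translation
      using measure_linear_image[OF matrix_vector_mul_linear[of A] S_meas] by simp
    then have "measure lborel (box l u) = \<bar>det A\<bar> * measure lborel S"
      using \<open>open S\<close> by simp
    moreover have "emeasure lborel S = measure lborel S"
      by (intro emeasure_eq_ennreal_measure)
         (use \<open>bounded S\<close> emeasure_bounded_finite in force)
    ultimately have "ennreal \<bar>det A\<bar> * emeasure lborel S = measure lborel (box l u)"
      by (simp add: ennreal_mult)
    also have "\<dots> = (\<Prod>b\<in>Basis. (u - l) \<bullet> b)"
      using le by (simp add: measure_lborel_box_eq inner_diff_left prod_ennreal)
    finally show "emeasure (density (distr lborel borel T) (\<lambda>_. ennreal \<bar>det A\<bar>)) (box l u) =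
        (\<Prod>b\<in>Basis. (u - l) \<bullet> b)"
      by (simp add: emeasure_density nn_integral_cmult emeasure_distr S_def)
  qed simp
  then have "(\<integral>\<^sup>+x. f x \<partial>lborel) =
      (\<integral>\<^sup>+x. f x \<partial>density (distr lborel borel T) (\<lambda>_. ennreal \<bar>det A\<bar>))"
    by simp
  also have "\<dots> = \<bar>det A\<bar> * (\<integral>\<^sup>+x. f (T x) \<partial>lborel)"
    by (simp add: nn_integral_density nn_integral_distr nn_integral_cmult)
  finally show ?thesis
    by (simp add: T_def)
qed

lemma vector3_measurable [measurable]:
  "(\<lambda>p. vector [fst p, fst (snd p), snd (snd p)] :: real^3) \<in> borel_measurable borel"
proof -
  have "(\<lambda>p. vector [fst p, fst (snd p), snd (snd p)] :: real^3) =
      (\<lambda>p. fst p *\<^sub>R axis 1 1 + fst (snd p) *\<^sub>R axis 2 1 + snd (snd p) *\<^sub>R axis 3 1)"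
    by (simp add: fun_eq_iff vec_eq_iff forall_3 axis_def)
  then show ?thesis
    by (simp add: borel_measurable_continuous_onI continuous_intros)
qed

text \<open>The preimage of a box under \<open>T\<close> is a product of three intervals, so
  \<open>lborel\<close> and the image measure agree on boxes; Fubini on the nested pairs then gives
  the iterated integral.\<close>

lemma nn_integral_lborel_vector3:
  fixes f :: "real^3 \<Rightarrow> ennreal"
  assumes [measurable]: "f \<in> borel_measurable borel"
  shows "(\<integral>\<^sup>+x. f x \<partial>lborel) = (\<integral>\<^sup>+p. \<integral>\<^sup>+q. \<integral>\<^sup>+r. f (vector [p, q, r]) \<partial>lborel \<partial>lborel \<partial>lborel)"
proof -
  define T :: "real \<times> real \<times> real \<Rightarrow> real^3"
    where "T = (\<lambda>p. vector [fst p, fst (snd p), snd (snd p)])"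
  have T_meas [measurable]: "T \<in> borel_measurable borel"
    unfolding T_def by (rule vector3_measurable)
  have "lborel = distr lborel borel T"
  proof (rule lborel_eqI)
    fix l u :: "real^3"
    assume "\<And>b. b \<in> Basis \<Longrightarrow> l \<bullet> b \<le> u \<bullet> b"
    then have le: "l $ i \<le> u $ i" for i
      by (metis axis_in_Basis_iff cart_eq_inner_axis zero_neq_one insertI1 Basis_real_def)
    have "T -` box l u = box (l$1) (u$1) \<times> box (l$2) (u$2) \<times> box (l$3) (u$3)"
      by (auto simp: T_def mem_box_cart forall_3)
    then have "emeasure (distr lborel borel T) (box l u) =
        emeasure (lborel \<Otimes>\<^sub>M (lborel :: (real \<times> real) measure))
          (box (l$1) (u$1) \<times> box (l$2) (u$2) \<times> box (l$3) (u$3))"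
      by (simp add: emeasure_distr lborel_prod)
    also have "\<dots> = emeasure lborel (box (l$1) (u$1)) *
        emeasure (lborel \<Otimes>\<^sub>M lborel) (box (l$2) (u$2) \<times> box (l$3) (u$3))"
      unfolding lborel_prod[symmetric, where 'a = real and 'b = real]
      by (rule sigma_finite_measure.emeasure_pair_measure_Times) 
         (simp_all add: lborel_prod sigma_finite_lborel)
    also have "\<dots> = ennreal (u$1 - l$1) * (ennreal (u$2 - l$2) * ennreal (u$3 - l$3))"
      using le by (subst lborel.emeasure_pair_measure_Times) simp_all
    also have "\<dots> = (\<Prod>b\<in>Basis. (u - l) \<bullet> b)"
    proof -
      have "(\<Prod>b\<in>Basis. (u - l) \<bullet> b) = (\<Prod>i\<in>UNIV. (u - l) $ i)"
        by (simp add: Basis_vec_def prod.UNION_disjoint axis_eq_axis inner_axis)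
      also have "\<dots> = (u$1 - l$1) * ((u$2 - l$2) * (u$3 - l$3))"
        unfolding UNIV_3 by simp
      finally show ?thesis
        using le[of 1] le[of 2] le[of 3] by (simp only: ennreal_mult mult_nonneg_nonneg diff_ge_0_iff_ge)
    qed
    finally show "emeasure (distr lborel borel T) (box l u) = (\<Prod>b\<in>Basis. (u - l) \<bullet> b)" .
  qed simp
  then have "(\<integral>\<^sup>+x. f x \<partial>lborel) = (\<integral>\<^sup>+x. f x \<partial>distr lborel borel T)"
    by simp
  also have "\<dots> = (\<integral>\<^sup>+p. f (T p) \<partial>lborel)"
    by (simp add: nn_integral_distr)
  also have "\<dots> = (\<integral>\<^sup>+p. \<integral>\<^sup>+s. f (T (p, s)) \<partial>lborel \<partial>lborel)"
    by (subst lborel_prod[symmetric], subst lborel.nn_integral_fst[symmetric])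
       (auto simp: lborel_prod)
  also have "\<dots> = (\<integral>\<^sup>+p. \<integral>\<^sup>+q. \<integral>\<^sup>+r. f (T (p, q, r)) \<partial>lborel \<partial>lborel \<partial>lborel)"
    by (intro nn_integral_cong, subst lborel_prod[symmetric], subst lborel.nn_integral_fst[symmetric])
       (auto simp: lborel_prod)
  finally show ?thesis
    by (simp add: T_def)
qed

section \<open>Mean distance as a double integral\<close>

text \<open>Left unnormalised, so that it scales by a pure power under similarities, and valued in
  \<open>ennreal\<close>, so that no integrability has to be carried along.\<close>

definition distance_integral :: "(real^3) set \<Rightarrow> ennreal" where
  "distance_integral T =
     (\<integral>\<^sup>+x. \<integral>\<^sup>+y. ennreal (norm (x - y)) * indicator T x * indicator T y \<partial>lborel \<partial>lborel)"

lemma expectation_norm_diff: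
  assumes ind: "independent_uniform_points M X Y T"
    and T [measurable]: "T \<in> sets borel" and pos: "measure lborel T > 0"
  shows "prob_space.expectation M (\<lambda>\<omega>. norm (X \<omega> - Y \<omega>)) =
    enn2real (distance_integral T) / (measure lborel T)\<^sup>2"
proof -
  interpret M: prob_space M
    using ind by (simp add: independent_uniform_points_def)
  have [measurable]: "X \<in> borel_measurable M" "Y \<in> borel_measurable M"
    and dX: "distr M borel X = uniform_measure lborel T"
    and dY: "distr M borel Y = uniform_measure lborel T"
    using ind by (auto simp: independent_uniform_points_def uniformly_distributed_in_def)
  have joint: "distr M borel X \<Otimes>\<^sub>M distr M borel Y = distr M (borel \<Otimes>\<^sub>M borel) (\<lambda>\<omega>. (X \<omega>, Y \<omega>))"
    using ind M.indep_var_distribution_eq by (auto simp: independent_uniform_points_def)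
  \<comment> \<open>\<open>measure\<close> returns 0 on sets of infinite measure, so positivity
    forces finiteness.\<close>
  have em: "emeasure lborel T = ennreal (measure lborel T)"
    using pos by (metis emeasure_eq_ennreal_measure enn2real_top less_irrefl measure_def)
  have sf: "sigma_finite_measure (distr M borel Y)"
    by (simp add: M.prob_space_distr prob_space_imp_sigma_finite)
  let ?m = "measure lborel T"
  let ?U = "uniform_measure lborel T"
  have "(\<integral>\<^sup>+\<omega>. norm (X \<omega> - Y \<omega>) \<partial>M) =
      (\<integral>\<^sup>+p. norm (fst p - snd p) \<partial>(distr M (borel \<Otimes>\<^sub>M borel) (\<lambda>\<omega>. (X \<omega>, Y \<omega>))))"
    by (subst nn_integral_distr) auto
  also have "\<dots> = (\<integral>\<^sup>+x. \<integral>\<^sup>+y. norm (x - y) \<partial>distr M borel Y \<partial>distr M borel X)"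
    unfolding joint[symmetric]
    by (subst sigma_finite_measure.nn_integral_fst[OF sf, symmetric]) auto
  also have "\<dots> = (\<integral>\<^sup>+x. (\<integral>\<^sup>+y. ennreal (norm (x - y)) * indicator T y \<partial>lborel) / ?m \<partial>?U)"
    unfolding dX dY by (simp add: nn_integral_uniform_measure em)
  also have "\<dots> = (\<integral>\<^sup>+x. (\<integral>\<^sup>+y. ennreal (norm (x - y)) * indicator T y \<partial>lborel) / ?m * indicator T x \<partial>lborel) / ?m"
    by (simp add: nn_integral_uniform_measure em)
  also have "\<dots> = (\<integral>\<^sup>+x. (\<integral>\<^sup>+y. ennreal (norm (x - y)) * indicator T x * indicator T y \<partial>lborel) / ?m \<partial>lborel) / ?m"
    by (intro arg_cong[where f = "\<lambda>u. u / ennreal ?m"] nn_integral_cong)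
       (simp split: split_indicator)
  also have "\<dots> = distance_integral T / ?m / ?m"
    unfolding distance_integral_def by (simp add: nn_integral_divide)
  also have "\<dots> = distance_integral T / ennreal (?m\<^sup>2)"
    using pos by (simp add: divide_ennreal_def mult.assoc power2_eq_square ennreal_mult
        ennreal_inverse_mult ennreal_mult_eq_top_iff)
  finally have nn: "(\<integral>\<^sup>+\<omega>. norm (X \<omega> - Y \<omega>) \<partial>M) = distance_integral T / ennreal (?m\<^sup>2)" .
  \<comment> \<open>\<open>enn2real\<close> maps infinity to 0, which matches the default value of
    the Bochner integral of a non-integrable function.\<close>
  have "prob_space.expectation M (\<lambda>\<omega>. norm (X \<omega> - Y \<omega>)) = enn2real (\<integral>\<^sup>+\<omega>. norm (X \<omega> - Y \<omega>) \<partial>M)"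
    by (rule integral_eq_nn_integral) auto
  also have "\<dots> = enn2real (distance_integral T) / ?m\<^sup>2"
    unfolding nn using pos
    by (simp add: divide_ennreal_def enn2real_mult inverse_ennreal divide_inverse)
  finally show ?thesis .
qed

text \<open>Dividing \<open>A\<close> by \<open>c\<close> gives an orthogonal matrix, of determinant
  1 or -1; scaling back multiplies three rows by \<open>c\<close>.\<close>

lemma abs_det_similarity:
  fixes A :: "real^3^3"
  assumes c: "c > 0" and norm: "\<And>x. norm (A *v x) = c * norm x"
  shows "\<bar>det A\<bar> = c ^ 3"
proof -
  define B where "B = (1 / c) *\<^sub>R A"
  have "orthogonal_transformation ((*v) B)"
    unfolding orthogonal_transformation B_def using c
    by (simp add: norm scaleR_matrix_vector_assoc[symmetric])
  then have "orthogonal_matrix B"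
    by (simp add: orthogonal_transformation_matrix)
  then have "\<bar>det B\<bar> = 1"
    using det_orthogonal_matrix by fastforce
  moreover have "A = c *\<^sub>R B"
    using c by (simp add: B_def)
  then have "det A = c ^ 3 * det B"
    by (simp add: det_3 algebra_simps power3_eq_cube)
  ultimately show ?thesis
    using c by (simp add: abs_mult)
qed

text \<open>The exponent 7 is 3 + 3 + 1: one Jacobian for each of the two points and one factor from
  the distance.\<close>

lemma distance_integral_similarity:
  fixes A :: "real^3^3"
  assumes c: "c > 0" and norm: "\<And>x. norm (A *v x) = c * norm x" and S [measurable]: "S \<in> sets borel"
    and T_def: "T = (\<lambda>x. a + A *v x) ` S" and T [measurable]: "T \<in> sets borel"
  shows "distance_integral T = ennreal (c ^ 7) * distance_integral S"
    and "emeasure lborel T = ennreal (c ^ 3) * emeasure lborel S"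
proof -
  have det: "\<bar>det A\<bar> = c ^ 3"
    using c norm by (rule abs_det_similarity)
  with c have nz: "det A \<noteq> 0"
    by auto
  have inj: "A *v x = A *v y \<longleftrightarrow> x = y" for x y
  proof -
    have "norm (A *v (x - y)) = c * norm (x - y)"
      by (rule norm)
    then show ?thesis
      using c by (auto simp: matrix_vector_mult_diff_distrib)
  qed
  have ind: "indicator T (a + A *v x) = (indicator S x :: ennreal)" for x
    by (auto simp: T_def inj split: split_indicator)
  have "emeasure lborel T = (\<integral>\<^sup>+x. indicator T x \<partial>lborel)"
    by simp
  also have "\<dots> = ennreal (c ^ 3) * emeasure lborel S"
    by (subst nn_integral_lborel_affine[OF _ nz, where a = a]) (simp_all add: det ind)
  finally show "emeasure lborel T = ennreal (c ^ 3) * emeasure lborel S" .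
  have diff: "norm (a + A *v x - (a + A *v y)) = c * norm (x - y)" for x y
    using norm[of "x - y"] by (simp add: matrix_vector_mult_diff_distrib)
  have "distance_integral T = ennreal (c ^ 3) * (\<integral>\<^sup>+x. \<integral>\<^sup>+y.
      ennreal (norm (a + A *v x - y)) * indicator S x * indicator T y \<partial>lborel \<partial>lborel)"
    unfolding distance_integral_def
    by (subst nn_integral_lborel_affine[OF _ nz, where a = a]) (simp_all add: det ind)
  also have "\<dots> = ennreal (c ^ 3) * (\<integral>\<^sup>+x. ennreal (c ^ 3) * (\<integral>\<^sup>+y.
      ennreal (c * norm (x - y)) * indicator S x * indicator S y \<partial>lborel) \<partial>lborel)"
    by (subst nn_integral_lborel_affine[OF _ nz, where a = a]) (simp_all only: det ind diff, simp_all)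
  also have "\<dots> = ennreal (c ^ 3) * (\<integral>\<^sup>+x. ennreal (c ^ 3) * (\<integral>\<^sup>+y.
      ennreal c * (ennreal (norm (x - y)) * indicator S x * indicator S y) \<partial>lborel) \<partial>lborel)"
    using c by (simp add: ennreal_mult mult.assoc)
  also have "\<dots> = ennreal (c ^ 3) * (ennreal (c ^ 3) * (ennreal c * distance_integral S))"
    unfolding distance_integral_def by (simp add: nn_integral_cmult)
  also have "\<dots> = ennreal (c ^ 7) * distance_integral S"
  proof -
    have "ennreal (c ^ 7) = ennreal (c ^ 3) * ennreal (c ^ 3) * ennreal c"
      using c by (simp add: ennreal_mult[symmetric] power_add[symmetric] flip: power_Suc2)
    then show ?thesis
      by (simp add: mult.assoc)
  qed
  finally show "distance_integral T = ennreal (c ^ 7) * distance_integral S" .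
qed

section \<open>Regular tetrahedra\<close>

text \<open>The four inequalities say that the barycentric coordinates of \<open>x\<close> are
  nonnegative, one for each facet.\<close>

lemma mem_K_tetrahedron:
  "x \<in> K_tetrahedron \<longleftrightarrow>
     1 \<le> x$1 + x$2 + x$3 \<and> x$2 + x$3 \<le> 1 + x$1 \<and> x$1 + x$3 \<le> 1 + x$2 \<and> x$1 + x$2 \<le> 1 + x$3"
  (is "_ \<longleftrightarrow> ?P x")
proof
  have "K_tetrahedron \<subseteq> {x. ?P x}"
    unfolding K_tetrahedron_def
  proof (rule hull_minimal)
    have "{x::real^3. ?P x} =
        {x. vector [-1, -1, -1] \<bullet> x \<le> -1} \<inter> {x. vector [-1, 1, 1] \<bullet> x \<le> 1} \<inter>
        {x. vector [1, -1, 1] \<bullet> x \<le> 1} \<inter> {x. vector [1, 1, -1] \<bullet> x \<le> 1}"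
      by (auto simp: inner_vec_def sum_3)
    then show "convex {x::real^3. ?P x}"
      by (simp add: convex_Int convex_halfspace_le)
  qed auto
  then show "x \<in> K_tetrahedron \<Longrightarrow> ?P x"
    by blast
next
  assume P: "?P x"
  \<comment> \<open>Barycentric coordinates of \<open>x\<close> with respect to the vertices listed
    in \<open>y\<close>, in the same order; they sum to 1 identically.\<close>
  define a where "a = (\<lambda>i::nat. [(1 + x$1 - x$2 - x$3) / 2, (1 + x$2 - x$1 - x$3) / 2,
      (1 + x$3 - x$1 - x$2) / 2, (x$1 + x$2 + x$3 - 1) / 2] ! i)"
  define y where "y = (\<lambda>i. [vector [1, 0, 0], vector [0, 1, 0], vector [0, 0, 1], vector [1, 1, 1] :: real^3] ! i)"
  have "(\<Sum>i<4. a i *\<^sub>R y i) \<in> K_tetrahedron"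
  proof (rule convex_sum)
    show "convex K_tetrahedron"
      by (simp add: K_tetrahedron_def)
    show "sum a {..<4} = 1"
      by (simp add: a_def eval_nat_numeral field_simps)
    show "0 \<le> a i" if "i \<in> {..<4}" for i
      using that P by (auto simp: a_def eval_nat_numeral less_Suc_eq)
    show "y i \<in> K_tetrahedron" if "i \<in> {..<4}" for i
      unfolding K_tetrahedron_def using that
      by (intro hull_inc) (auto simp: y_def eval_nat_numeral less_Suc_eq)
  qed simp
  also have "(\<Sum>i<4. a i *\<^sub>R y i) = x"
    by (simp add: a_def y_def eval_nat_numeral vec_eq_iff forall_3 field_simps)
  finally show "x \<in> K_tetrahedron" .
qed

lemma measurable_K_tetrahedron [measurable]: "K_tetrahedron \<in> sets borel"
  unfolding K_tetrahedron_def
  by (intro borel_compact finite_imp_compact_convex_hull) auto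

lemma measure_K_tetrahedron: "measure lborel K_tetrahedron = 1 / 3"
proof -
  \<comment> \<open>\<open>content_simplex\<close> wants a base vertex, here (1,1,1), and an
    enumeration of the others by the index type.\<close>
  define f :: "3 \<Rightarrow> real^3"
    where "f = (\<lambda>i. if i = 1 then vector [1, 0, 0] else if i = 2 then vector [0, 1, 0] else vector [0, 0, 1])"
  let ?V = "{vector [1, 0, 0], vector [0, 1, 0], vector [0, 0, 1], vector [1, 1, 1] :: real^3}"
  have "measure lborel (convex hull ?V) = \<bar>det (\<chi> i j. f j $ i - vector [1, 1, 1] $ i)\<bar> / fact CARD(3)"
  proof (rule content_simplex)
    show "bij_betw f UNIV (?V - {vector [1, 1, 1]})"
      unfolding bij_betw_def inj_on_def UNIV_3
      by (auto simp: f_def vec_eq_iff forall_3)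
    show "card ?V = Suc CARD(3)"
      by (simp add: vec_eq_iff forall_3)
  qed auto
  also have "\<dots> = 1 / 3"
    by (simp add: det_3 f_def eval_nat_numeral)
  finally show ?thesis
    by (simp add: K_tetrahedron_def)
qed

lemma emeasure_K_tetrahedron: "emeasure lborel K_tetrahedron = ennreal (1 / 3)"
  using measure_K_tetrahedron
  by (metis emeasure_eq_ennreal_measure enn2real_top measure_def zero_neq_one divide_eq_0_iff zero_neq_numeral)

lemma regular_K_tetrahedron: "regular_tetrahedron K_tetrahedron"
  unfolding regular_tetrahedron_def
proof (intro exI conjI)
  let ?V = "{vector [1, 0, 0], vector [0, 1, 0], vector [0, 0, 1], vector [1, 1, 1] :: real^3}"
  show "card ?V = 4"
    by (simp add: vec_eq_iff forall_3)
  show "pairwise (\<lambda>v w. dist v w = sqrt 2) ?V"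
    by (auto simp: pairwise_insert dist_norm norm_eq_sqrt_inner inner_vec_def sum_3)
  show "K_tetrahedron = convex hull ?V"
    by (rule K_tetrahedron_def)
qed

text \<open>Equal edges fix the Gram matrix of the three edge vectors at a vertex: s^2 on the
  diagonal and s^2/2 off it. For \<open>K_tetrahedron\<close> the Gram matrix is proportional to
  this one, and proportional Gram matrices mean that the linear map between the edge vectors is a
  similarity.\<close>

lemma regular_tetrahedron_similar_K:
  assumes "regular_tetrahedron T"
  obtains a c and A :: "real^3^3"
  where "c > 0" "\<And>x. norm (A *v x) = c * norm x" "T = (\<lambda>x. a + A *v x) ` K_tetrahedron"
proof -
  obtain V s where V: "card V = 4" "pairwise (\<lambda>v w. dist v w = s) V" "T = convex hull V"
    using assms unfolding regular_tetrahedron_def by blast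
  obtain v0 W where W: "V = insert v0 W" "v0 \<notin> W" "card W = 3"
    using V(1) by (metis card_Suc_eq eval_nat_numeral(2) semiring_norm(26,27))
  obtain v1 v2 v3 where v: "W = {v1, v2, v3}" "v1 \<noteq> v2" "v2 \<noteq> v3" "v1 \<noteq> v3"
    using W(3) by (auto simp: card_3_iff)
  define w1 w2 w3 where w_def: "w1 = v1 - v0" "w2 = v2 - v0" "w3 = v3 - v0"
  have d: "dist v0 v1 = s" "dist v0 v2 = s" "dist v0 v3 = s" "dist v1 v2 = s" "dist v2 v3 = s" "dist v1 v3 = s"
    using V(2) W v by (auto simp: pairwise_insert)
  have s: "s > 0"
    using d(4) v(2) by auto
  have ww: "w1 \<bullet> w1 = s\<^sup>2" "w2 \<bullet> w2 = s\<^sup>2" "w3 \<bullet> w3 = s\<^sup>2"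
    using d(1-3) by (auto simp: w_def dist_norm norm_minus_commute power2_norm_eq_inner[symmetric])
  have "(w1 - w2) \<bullet> (w1 - w2) = s\<^sup>2" "(w2 - w3) \<bullet> (w2 - w3) = s\<^sup>2" "(w1 - w3) \<bullet> (w1 - w3) = s\<^sup>2"
    using d(4-6) by (auto simp: w_def dist_norm power2_norm_eq_inner[symmetric])
  then have wx: "w1 \<bullet> w2 = s\<^sup>2 / 2" "w2 \<bullet> w3 = s\<^sup>2 / 2" "w1 \<bullet> w3 = s\<^sup>2 / 2"
    using ww by (auto simp: inner_diff_left inner_diff_right inner_commute)
  \<comment> \<open>The edge vectors of \<open>K\<close> at \<open>(1,1,1)\<close> are \<open>(0,-1,-1)\<close>, \<open>(-1,0,-1)\<close>, \<open>(-1,-1,0)\<close>;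
    \<open>f1\<close>, \<open>f2\<close>, \<open>f3\<close> are the images of the unit vectors under the linear map that sends them to
    \<open>w1\<close>, \<open>w2\<close>, \<open>w3\<close>.\<close>
  define f1 f2 f3 where f_def: "f1 = (1/2) *\<^sub>R (w1 - w2 - w3)" "f2 = (1/2) *\<^sub>R (w2 - w1 - w3)"
    "f3 = (1/2) *\<^sub>R (w3 - w1 - w2)"
  define A :: "real^3^3" where "A = transpose (vector [f1, f2, f3])"
  have A: "A *v x = x$1 *\<^sub>R f1 + x$2 *\<^sub>R f2 + x$3 *\<^sub>R f3" for x
    by (simp add: A_def matrix_vector_mult_def transpose_def vec_eq_iff sum_3 mult.commute)
  have ff: "f1 \<bullet> f1 = s\<^sup>2 / 2" "f2 \<bullet> f2 = s\<^sup>2 / 2" "f3 \<bullet> f3 = s\<^sup>2 / 2"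
    "f1 \<bullet> f2 = 0" "f1 \<bullet> f3 = 0" "f2 \<bullet> f3 = 0"
    using wx ww by (simp_all add: f_def inner_diff_left inner_diff_right inner_commute)
  \<comment> \<open>The ratio compares edge lengths: \<open>K_tetrahedron\<close> has edge sqrt
    2.\<close>
  have nrm: "norm (A *v x) = s / sqrt 2 * norm x" for x
  proof -
    have eq: "(A *v x) \<bullet> (A *v x) = (s\<^sup>2 / 2) * (x \<bullet> x)"
      unfolding A
      by (simp add: ff inner_add_left inner_add_right inner_commute inner_vec_def[of x x] sum_3 algebra_simps)
    then show ?thesis
      unfolding norm_eq_sqrt_inner eq using s by (simp add: real_sqrt_mult real_sqrt_divide)
  qed
  define a where "a = v0 - A *v vector [1, 1, 1]"
  have "(\<lambda>x. a + A *v x) ` K_tetrahedron = T"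
  proof -
    have "(\<lambda>x. a + A *v x) ` K_tetrahedron = (+) a ` ((*v) A ` K_tetrahedron)"
      by (simp add: image_image)
    also have "\<dots> = convex hull ((\<lambda>x. a + A *v x) `
        {vector [1, 0, 0], vector [0, 1, 0], vector [0, 0, 1], vector [1, 1, 1]})"
      unfolding K_tetrahedron_def
      by (subst convex_hull_linear_image, simp,
          simp add: convex_hull_translation[symmetric] image_image)
    also have "(\<lambda>x. a + A *v x) ` {vector [1, 0, 0], vector [0, 1, 0], vector [0, 0, 1], vector [1, 1, 1]} =
        {v1, v2, v3, v0}"
    proof -
      have "a + A *v vector [1, 0, 0] = v1" "a + A *v vector [0, 1, 0] = v2"
        "a + A *v vector [0, 0, 1] = v3" "a + A *v vector [1, 1, 1] = v0"
        unfolding a_def A f_def w_def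
        by (simp_all add: vec_eq_iff field_simps)
      then show ?thesis
        by simp
    qed
    also have "\<dots> = V"
      using W v by auto
    finally show ?thesis
      using V(3) by simp
  qed
  with s nrm show ?thesis
    using that[of "s / sqrt 2" A a] by simp
qed

section \<open>Overlap of the tetrahedron with its translates\<close>

text \<open>The norm whose unit ball is the cuboctahedron \<open>K - K\<close>.\<close>
definition cubocta_norm :: "real^3 \<Rightarrow> real" where
  "cubocta_norm z = (\<bar>z$1 - z$2 - z$3\<bar> + \<bar>z$2 - z$1 - z$3\<bar> + \<bar>z$3 - z$1 - z$2\<bar> + \<bar>z$1 + z$2 + z$3\<bar>) / 4"

lemma measurable_cubocta_norm [measurable]: "cubocta_norm \<in> borel_measurable borel"
  unfolding cubocta_norm_def by measurable

text \<open>Translation by \<open>z\<close> changes each barycentric coordinate by a linear form in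
  \<open>z\<close>; \<open>m1\<close> to \<open>m4\<close> are the resulting losses, cut off at 0,
  hence the least values the coordinates of \<open>x\<close> may take. The four changes sum to 0, so
  the total loss is half the sum of their absolute values, which is
  \<open>cubocta_norm z\<close>.\<close>

lemma mem_K_tetrahedron_shift:
  fixes z :: "real^3"
  defines "m1 \<equiv> max 0 ((z$2 + z$3 - z$1) / 2)" and "m2 \<equiv> max 0 ((z$1 + z$3 - z$2) / 2)"
    and "m3 \<equiv> max 0 ((z$1 + z$2 - z$3) / 2)" and "m4 \<equiv> max 0 (- (z$1 + z$2 + z$3) / 2)"
  shows "x \<in> K_tetrahedron \<and> x + z \<in> K_tetrahedron \<longleftrightarrow>
      m1 \<le> (1 + x$1 - x$2 - x$3) / 2 \<and> m2 \<le> (1 + x$2 - x$1 - x$3) / 2 \<and>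
      m3 \<le> (1 + x$3 - x$1 - x$2) / 2 \<and> m4 \<le> (x$1 + x$2 + x$3 - 1) / 2"
    and "cubocta_norm z = m1 + m2 + m3 + m4"
proof -
  show "x \<in> K_tetrahedron \<and> x + z \<in> K_tetrahedron \<longleftrightarrow>
      m1 \<le> (1 + x$1 - x$2 - x$3) / 2 \<and> m2 \<le> (1 + x$2 - x$1 - x$3) / 2 \<and>
      m3 \<le> (1 + x$3 - x$1 - x$2) / 2 \<and> m4 \<le> (x$1 + x$2 + x$3 - 1) / 2"
    unfolding mem_K_tetrahedron m1_def m2_def m3_def m4_def max.bounded_iff vector_add_component by argo
  have max_abs: "max 0 t = (\<bar>t\<bar> + t) / 2" for t :: real
    by (auto simp: max_def)
  have "\<bar>(z$2 + z$3 - z$1) / 2\<bar> = \<bar>z$1 - z$2 - z$3\<bar> / 2" "\<bar>(z$1 + z$3 - z$2) / 2\<bar> = \<bar>z$2 - z$1 - z$3\<bar> / 2"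
    "\<bar>(z$1 + z$2 - z$3) / 2\<bar> = \<bar>z$3 - z$1 - z$2\<bar> / 2" "\<bar>- (z$1 + z$2 + z$3) / 2\<bar> = \<bar>z$1 + z$2 + z$3\<bar> / 2"
    by (auto simp: abs_if field_simps)
  then show "cubocta_norm z = m1 + m2 + m3 + m4"
    unfolding m1_def m2_def m3_def m4_def cubocta_norm_def max_abs by (simp add: field_simps)
qed

text \<open>The intersection of a simplex with a translate of it is a smaller homothetic copy:
  in barycentric coordinates it is \<open>{\<lambda>. \<lambda> i \<ge> m i}\<close> with \<open>m \<ge> 0\<close>, whose
  ratio of homothety is \<open>1 - (m 1 + m 2 + m 3 + m 4)\<close>.\<close>
lemma emeasure_overlap_K_tetrahedron:
  "(\<integral>\<^sup>+x. indicator K_tetrahedron x * indicator K_tetrahedron (x + z) \<partial>lborel) =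
     ennreal ((max 0 (1 - cubocta_norm z)) ^ 3 / 3)"
proof -
  define m1 m2 m3 m4 where m: "m1 = max 0 ((z$2 + z$3 - z$1) / 2)" "m2 = max 0 ((z$1 + z$3 - z$2) / 2)"
    "m3 = max 0 ((z$1 + z$2 - z$3) / 2)" "m4 = max 0 (- (z$1 + z$2 + z$3) / 2)"
  note shift = mem_K_tetrahedron_shift[where z = z, folded m]
  define t where "t = 1 - cubocta_norm z"
  have t: "t = 1 - m1 - m2 - m3 - m4"
    using shift(2) by (simp add: t_def)
  \<comment> \<open>This is the combination of the vertices of K with weights \<open>m1\<close> to
    \<open>m4\<close>, so that x \<mapsto> s + t x sends barycentric coordinates l to m + t
    l.\<close>
  define s :: "real^3" where "s = vector [m1 + m4, m2 + m4, m3 + m4]"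
  let ?f = "\<lambda>x. indicator K_tetrahedron x * indicator K_tetrahedron (x + z) :: ennreal"
  show ?thesis
  proof (cases "t > 0")
    case True
    have det: "det (t *\<^sub>R mat 1 :: real^3^3) = t ^ 3"
      by (simp add: det_3 mat_def power3_eq_cube)
    have eq: "?f (s + (t *\<^sub>R mat 1) *v x) = indicator K_tetrahedron x" for x
    proof -
      let ?y = "s + t *\<^sub>R x"
      have "(1 + ?y$1 - ?y$2 - ?y$3) / 2 - m1 = t * ((1 + x$1 - x$2 - x$3) / 2)"
        "(1 + ?y$2 - ?y$1 - ?y$3) / 2 - m2 = t * ((1 + x$2 - x$1 - x$3) / 2)"
        "(1 + ?y$3 - ?y$1 - ?y$2) / 2 - m3 = t * ((1 + x$3 - x$1 - x$2) / 2)"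
        "(?y$1 + ?y$2 + ?y$3 - 1) / 2 - m4 = t * ((x$1 + x$2 + x$3 - 1) / 2)"
        unfolding s_def t by (simp_all add: field_simps)
      moreover have "m \<le> a \<longleftrightarrow> 0 \<le> b" if "a - m = t * (b / 2)" for m a b :: real
        using that True by (metis diff_ge_0_iff_ge divide_nonneg_pos half_gt_zero_iff 
            zero_le_mult_iff less_le_not_le zero_less_numeral zero_le_divide_iff)
      ultimately have "?y \<in> K_tetrahedron \<and> ?y + z \<in> K_tetrahedron \<longleftrightarrow> 0 \<le> 1 + x$1 - x$2 - x$3 \<and>
          0 \<le> 1 + x$2 - x$1 - x$3 \<and> 0 \<le> 1 + x$3 - x$1 - x$2 \<and> 0 \<le> x$1 + x$2 + x$3 - 1"
        unfolding shift(1) by presburger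
      also have "\<dots> \<longleftrightarrow> x \<in> K_tetrahedron"
        unfolding mem_K_tetrahedron by argo
      finally show ?thesis
        by (auto simp: scaleR_matrix_vector_assoc[symmetric] split: split_indicator)
    qed
    have "(\<integral>\<^sup>+x. ?f x \<partial>lborel) = ennreal (t ^ 3) * (\<integral>\<^sup>+x. ?f (s + (t *\<^sub>R mat 1) *v x) \<partial>lborel)"
      using True by (subst nn_integral_lborel_affine[where a = s and A = "t *\<^sub>R mat 1"])
        (simp_all add: det)
    also have "\<dots> = ennreal (t ^ 3) * ennreal (1 / 3)"
      unfolding eq by (simp add: emeasure_K_tetrahedron)
    also have "\<dots> = ennreal (t ^ 3 / 3)"
      using True by (simp add: ennreal_mult[symmetric])
    finally show ?thesis
      using True by (simp add: t_def)
  next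
    case False
    \<comment> \<open>The lower bounds now sum to 1 - t \<ge> 1, while the coordinates themselves
      sum to 1. All bounds must therefore be attained, and the overlap is at most one point, a null
      set.\<close>
    have "?f x \<le> indicator {s} x" for x
    proof (cases "x \<in> K_tetrahedron \<and> x + z \<in> K_tetrahedron")
      case True
      then have "m1 \<le> (1 + x$1 - x$2 - x$3) / 2" "m2 \<le> (1 + x$2 - x$1 - x$3) / 2"
        "m3 \<le> (1 + x$3 - x$1 - x$2) / 2" "m4 \<le> (x$1 + x$2 + x$3 - 1) / 2"
        using shift(1)[of x] by auto
      then have "x$1 = m1 + m4 \<and> x$2 = m2 + m4 \<and> x$3 = m3 + m4"
        using False unfolding t by (intro conjI) (simp_all add: field_simps)
      then have "x = s"
        by (simp add: s_def vec_eq_iff forall_3)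
      then show ?thesis
        by (auto split: split_indicator)
    qed (auto split: split_indicator)
    then have "(\<integral>\<^sup>+x. ?f x \<partial>lborel) \<le> (\<integral>\<^sup>+x. indicator {s} x \<partial>lborel)"
      by (intro nn_integral_mono)
    then show ?thesis
      using False by (simp add: t_def)
  qed
qed

lemma distance_integral_K_tetrahedron:
  "distance_integral K_tetrahedron =
     (\<integral>\<^sup>+z. ennreal (norm z * (max 0 (1 - cubocta_norm z)) ^ 3) \<partial>lborel) / 3"
proof -
  let ?K = "\<lambda>x. indicator K_tetrahedron x :: ennreal"
  have "distance_integral K_tetrahedron =
      (\<integral>\<^sup>+x. \<integral>\<^sup>+z. ennreal (norm z) * (?K x * ?K (x + z)) \<partial>lborel \<partial>lborel)"
    unfolding distance_integral_def
  proof (rule nn_integral_cong)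
    fix x :: "real^3"
    have "(\<integral>\<^sup>+y. ennreal (norm (x - y)) * ?K x * ?K y \<partial>lborel) =
        (\<integral>\<^sup>+z. ennreal (norm (x - (x + mat 1 *v z))) * ?K x * ?K (x + mat 1 *v z) \<partial>lborel)"
      by (subst nn_integral_lborel_affine[where a = x and A = "mat 1"]) simp_all
    then show "(\<integral>\<^sup>+y. ennreal (norm (x - y)) * ?K x * ?K y \<partial>lborel) =
        (\<integral>\<^sup>+z. ennreal (norm z) * (?K x * ?K (x + z)) \<partial>lborel)"
      by (simp add: mult.assoc)
  qed
  also have "\<dots> = (\<integral>\<^sup>+z. \<integral>\<^sup>+x. ennreal (norm z) * (?K x * ?K (x + z)) \<partial>lborel \<partial>lborel)"
    by (rule lborel_pair.Fubini') measurable
  also have "\<dots> = (\<integral>\<^sup>+z. ennreal (norm z * (max 0 (1 - cubocta_norm z)) ^ 3) / 3 \<partial>lborel)"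
    by (intro nn_integral_cong, subst nn_integral_cmult)
       (auto simp: emeasure_overlap_K_tetrahedron ennreal_mult ennreal_times_divide divide_ennreal[symmetric])
  also have "\<dots> = (\<integral>\<^sup>+z. ennreal (norm z * (max 0 (1 - cubocta_norm z)) ^ 3) \<partial>lborel) / 3"
    by (rule nn_integral_divide) measurable
  finally show ?thesis .
qed

section \<open>Octahedral symmetry\<close>

lemma AE_hyperplane:
  fixes a :: "'a::euclidean_space"
  assumes "a \<noteq> 0"
  shows "AE x in lborel. a \<bullet> x \<noteq> 0"
proof -
  have "negligible {x. a \<bullet> x = 0}"
    using assms by (intro negligible_hyperplane) auto
  then have "{x. a \<bullet> x = 0} \<in> null_sets lborel"
    by (simp add: negligible_iff_null_sets null_sets_completion_iff)
  then show ?thesis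
    by (simp add: AE_iff_null)
qed

text \<open>Almost every x has exactly one of its iterates x, A x, ..., A^(n-1) x in
  \<open>D\<close>. Inserting this sum of indicators as a factor 1 and substituting in each term
  gives \<open>n\<close> copies of the integral over \<open>D\<close>, by invariance of
  \<open>f\<close> and of volume.\<close>

lemma nn_integral_fundamental_domain:
  fixes A :: "real^3^3" and f :: "real^3 \<Rightarrow> ennreal"
  assumes [measurable]: "f \<in> borel_measurable borel" "D \<in> sets borel"
    and det: "\<bar>det A\<bar> = 1" and inv: "\<And>x. f (A *v x) = f x"
    and tiling: "AE x in lborel. (\<Sum>i<n. indicator D (((*v) A ^^ i) x)) = (1::ennreal)"
  shows "(\<integral>\<^sup>+x. f x \<partial>lborel) = of_nat n * (\<integral>\<^sup>+x. f x * indicator D x \<partial>lborel)"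
proof -
  have meas [measurable]: "((*v) A ^^ i) \<in> borel_measurable borel" for i
  proof (induction i)
    case (Suc i)
    have "(*v) A \<in> borel_measurable borel"
      by (intro borel_measurable_continuous_onI linear_continuous_on) (simp add: linear_linear)
    with Suc show ?case
      by (simp add: measurable_comp)
  qed (simp add: id_def)
  have inv': "f (((*v) A ^^ i) x) = f x" for i x
    by (induction i) (simp_all add: inv)
  have pull: "(\<integral>\<^sup>+x. h (((*v) A ^^ i) x) \<partial>lborel) = (\<integral>\<^sup>+x. h x \<partial>lborel)"
    if [measurable]: "h \<in> borel_measurable borel" for h :: "real^3 \<Rightarrow> ennreal" and i
  proof (induction i)
    case (Suc i)
    have "(\<integral>\<^sup>+x. h (((*v) A ^^ i) x) \<partial>lborel) = (\<integral>\<^sup>+x. h (((*v) A ^^ i) (0 + A *v x)) \<partial>lborel)"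
      using det by (subst nn_integral_lborel_affine[where A = A and a = 0]) auto
    then show ?case
      using Suc by (simp add: funpow_swap1)
  qed simp
  have "(\<integral>\<^sup>+x. f x \<partial>lborel) = (\<integral>\<^sup>+x. f x * (\<Sum>i<n. indicator D (((*v) A ^^ i) x)) \<partial>lborel)"
    using tiling by (intro nn_integral_cong_AE) auto
  also have "\<dots> = (\<integral>\<^sup>+x. (\<Sum>i<n. f (((*v) A ^^ i) x) * indicator D (((*v) A ^^ i) x)) \<partial>lborel)"
    by (simp add: inv' sum_distrib_left)
  also have "\<dots> = (\<Sum>i<n. \<integral>\<^sup>+x. f (((*v) A ^^ i) x) * indicator D (((*v) A ^^ i) x) \<partial>lborel)"
    by (intro nn_integral_sum) measurable
  also have "\<dots> = (\<Sum>i<n. \<integral>\<^sup>+x. f x * indicator D x \<partial>lborel)"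
    by (intro sum.cong refl pull[where h = "\<lambda>x. f x * indicator D x"]) measurable
  finally show ?thesis
    by simp
qed

text \<open>The three invariances generate the full symmetry group of the cube. Its order 48 = 2 * 2
  * 2 * 3 * 2 is collected from five cyclic steps: three sign changes, a 3-cycle and a swap.\<close>

lemma nn_integral_octahedral_symmetry:
  fixes f :: "real^3 \<Rightarrow> ennreal"
  assumes [measurable]: "f \<in> borel_measurable borel"
    and flip: "\<And>x y z. f (vector [-x, y, z]) = f (vector [x, y, z])"
    and cyc: "\<And>x y z. f (vector [y, z, x]) = f (vector [x, y, z])"
    and swap: "\<And>x y z. f (vector [x, z, y]) = f (vector [x, y, z])"
  shows "(\<integral>\<^sup>+x. f x \<partial>lborel) =
    48 * (\<integral>\<^sup>+x. f x * indicator {x. x$1 \<ge> x$2 \<and> x$2 \<ge> x$3 \<and> x$3 \<ge> 0} x \<partial>lborel)"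
proof -
  define F1 F2 F3 C S :: "real^3^3" where mats:
    "F1 = vector [vector [-1, 0, 0], vector [0, 1, 0], vector [0, 0, 1]]"
    "F2 = vector [vector [1, 0, 0], vector [0, -1, 0], vector [0, 0, 1]]"
    "F3 = vector [vector [1, 0, 0], vector [0, 1, 0], vector [0, 0, -1]]"
    "C = vector [vector [0, 1, 0], vector [0, 0, 1], vector [1, 0, 0]]"
    "S = vector [vector [1, 0, 0], vector [0, 0, 1], vector [0, 1, 0]]"
  have app: "F1 *v x = vector [- x$1, x$2, x$3]" "F2 *v x = vector [x$1, - x$2, x$3]"
    "F3 *v x = vector [x$1, x$2, - x$3]" "C *v x = vector [x$2, x$3, x$1]"
    "S *v x = vector [x$1, x$3, x$2]" for x
    by (simp_all add: mats vec_eq_iff forall_3 matrix_vector_mult_def sum_3)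
  have det: "\<bar>det F1\<bar> = 1" "\<bar>det F2\<bar> = 1" "\<bar>det F3\<bar> = 1" "\<bar>det C\<bar> = 1" "\<bar>det S\<bar> = 1"
    by (simp_all add: mats det_3)
  have vec: "vector [x$1, x$2, x$3] = x" for x :: "real^3"
    by (simp add: vec_eq_iff forall_3)
  have f_inv: "f (vector [- x$1, x$2, x$3]) = f x" "f (vector [x$2, x$3, x$1]) = f x"
    "f (vector [x$1, x$3, x$2]) = f x" for x
    using flip[of "x$1" "x$2" "x$3"] cyc[of "x$2" "x$3" "x$1"] swap[of "x$1" "x$3" "x$2"] vec[of x] by simp_all
  have f_inv2: "f (vector [x$1, - x$2, x$3]) = f x" for x
    using flip[of "x$2" "x$3" "x$1"] cyc vec[of x] by metis
  have f_inv3: "f (vector [x$1, x$2, - x$3]) = f x" for x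
    using flip[of "x$3" "x$1" "x$2"] cyc vec[of x] by metis
  have AE: "AE x::real^3 in lborel. x$1 \<noteq> 0 \<and> x$2 \<noteq> 0 \<and> x$3 \<noteq> 0 \<and> x$1 \<noteq> x$2 \<and> x$1 \<noteq> x$3 \<and> x$2 \<noteq> x$3"
    using AE_hyperplane[of "vector [1, 0, 0] :: real^3"] AE_hyperplane[of "vector [0, 1, 0] :: real^3"]
      AE_hyperplane[of "vector [0, 0, 1] :: real^3"] AE_hyperplane[of "vector [1, -1, 0] :: real^3"]
      AE_hyperplane[of "vector [1, 0, -1] :: real^3"] AE_hyperplane[of "vector [0, 1, -1] :: real^3"]
    by (simp add: inner_vec_def sum_3 vec_eq_iff forall_3)
  let ?i1 = "indicator {x::real^3. 0 \<le> x$1} :: _ \<Rightarrow> ennreal"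
  let ?i2 = "indicator {x::real^3. 0 \<le> x$2} :: _ \<Rightarrow> ennreal"
  let ?i3 = "indicator {x::real^3. 0 \<le> x$3} :: _ \<Rightarrow> ennreal"
  let ?i4 = "indicator {x::real^3. x$2 \<le> x$1 \<and> x$3 \<le> x$1} :: _ \<Rightarrow> ennreal"
  let ?i5 = "indicator {x::real^3. x$3 \<le> x$2} :: _ \<Rightarrow> ennreal"
  have tiling_F1: "AE x in lborel. (\<Sum>i<2. ?i1 (((*v) F1 ^^ i) x)) = 1"
    using AE by (rule eventually_mono) (auto simp: eval_nat_numeral app split: split_indicator)
  have tiling_F2: "AE x in lborel. (\<Sum>i<2. ?i2 (((*v) F2 ^^ i) x)) = 1"
    using AE by (rule eventually_mono) (auto simp: eval_nat_numeral app split: split_indicator)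
  have tiling_F3: "AE x in lborel. (\<Sum>i<2. ?i3 (((*v) F3 ^^ i) x)) = 1"
    using AE by (rule eventually_mono) (auto simp: eval_nat_numeral app split: split_indicator)
  have tiling_C: "AE x in lborel. (\<Sum>i<3. ?i4 (((*v) C ^^ i) x)) = 1"
    using AE by (rule eventually_mono) (auto simp: eval_nat_numeral app split: split_indicator)
  have tiling_S: "AE x in lborel. (\<Sum>i<2. ?i5 (((*v) S ^^ i) x)) = 1"
    using AE by (rule eventually_mono) (auto simp: eval_nat_numeral app split: split_indicator)
  \<comment> \<open>The order of the reductions matters: the integrand cut down so far must be
    invariant under the next matrix. Sign changes leave the other sign conditions alone,
    permutations preserve the octant, and the last swap preserves the condition that the first
    coordinate is the largest.\<close>
  have "(\<integral>\<^sup>+x. f x \<partial>lborel) =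
      of_nat 2 * (\<integral>\<^sup>+x. f x * ?i1 x \<partial>lborel)"
    by (rule nn_integral_fundamental_domain[OF _ _ _ _ tiling_F1])
       (auto simp: det app f_inv split: split_indicator)
  also have "(\<integral>\<^sup>+x. f x * ?i1 x \<partial>lborel) =
      of_nat 2 * (\<integral>\<^sup>+x. f x * ?i1 x * ?i2 x \<partial>lborel)"
    by (rule nn_integral_fundamental_domain[OF _ _ _ _ tiling_F2])
       (auto simp: det app f_inv2 split: split_indicator)
  also have "(\<integral>\<^sup>+x. f x * ?i1 x * ?i2 x \<partial>lborel) =
      of_nat 2 * (\<integral>\<^sup>+x. f x * ?i1 x * ?i2 x * ?i3 x \<partial>lborel)"
    by (rule nn_integral_fundamental_domain[OF _ _ _ _ tiling_F3])
       (auto simp: det app f_inv3 split: split_indicator)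
  also have "(\<integral>\<^sup>+x. f x * ?i1 x * ?i2 x * ?i3 x \<partial>lborel) =
      of_nat 3 * (\<integral>\<^sup>+x. f x * ?i1 x * ?i2 x * ?i3 x * ?i4 x \<partial>lborel)"
    by (rule nn_integral_fundamental_domain[OF _ _ _ _ tiling_C])
       (auto simp: det app f_inv split: split_indicator)
  also have "(\<integral>\<^sup>+x. f x * ?i1 x * ?i2 x * ?i3 x * ?i4 x \<partial>lborel) =
      of_nat 2 * (\<integral>\<^sup>+x. f x * ?i1 x * ?i2 x * ?i3 x * ?i4 x * ?i5 x \<partial>lborel)"
    by (rule nn_integral_fundamental_domain[OF _ _ _ _ tiling_S])
       (auto simp: det app f_inv split: split_indicator)
  also have "(\<lambda>x. f x * ?i1 x * ?i2 x * ?i3 x * ?i4 x * ?i5 x) =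
      (\<lambda>x. f x * indicator {x. x$1 \<ge> x$2 \<and> x$2 \<ge> x$3 \<and> x$3 \<ge> 0} x)"
    by (auto simp: fun_eq_iff indicator_def)
  finally show ?thesis
    by (simp add: mult.assoc[symmetric])
qed

section \<open>Integration over cones\<close>

lemma measurable_indicator_Icc [measurable (raw)]:
  fixes f g h :: "'a \<Rightarrow> real"
  assumes [measurable]: "f \<in> borel_measurable M" "g \<in> borel_measurable M" "h \<in> borel_measurable M"
  shows "(\<lambda>x. indicator {f x..g x} (h x) :: ennreal) \<in> borel_measurable M"
    and "(\<lambda>x. indicator {..g x} (h x) :: ennreal) \<in> borel_measurable M"
  unfolding indicator_def atLeastAtMost_iff atMost_iff by measurable

text \<open>This is B(4,4) = 3! 3! / 7!. In p^3, two factors come from the volume element and one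
  from the norm; (1 - p)^3 is the overlap weight.\<close>

lemma nn_integral_weight: "(\<integral>\<^sup>+p. ennreal (p ^ 3 * (1 - p) ^ 3) * indicator {0..1} p \<partial>lborel) = ennreal (1 / 140)"
proof -
  have "(\<integral>\<^sup>+p. ennreal (p ^ 3 * (1 - p) ^ 3) * indicator {0..1} p \<partial>lborel) =
      ennreal ((1 ^ 4 / 4 - 3 * 1 ^ 5 / 5 + 1 ^ 6 / 2 - 1 ^ 7 / 7) - (0 ^ 4 / 4 - 3 * 0 ^ 5 / 5 + 0 ^ 6 / 2 - 0 ^ 7 / 7))"
  proof (rule nn_integral_FTC_Icc)
    fix p :: real assume "p \<in> {0..1}"
    then show "0 \<le> p ^ 3 * (1 - p) ^ 3"
      by simp
    show "((\<lambda>p. p ^ 4 / 4 - 3 * p ^ 5 / 5 + p ^ 6 / 2 - p ^ 7 / 7) has_real_derivative p ^ 3 * (1 - p) ^ 3) (at p)"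
      by (auto intro!: derivative_eq_intros simp: algebra_simps eval_nat_numeral)
  qed auto
  then show ?thesis
    by simp
qed

text \<open>The factor \<open>u\<close>, which the substitution r = p u w supplies, makes the
  integrand the exact derivative of (\<alpha> + c u^2)^(3/2) / (3 c).\<close>

lemma nn_integral_radial:
  fixes \<alpha> c :: real
  assumes "\<alpha> > 0" "c > 0"
  shows "(\<integral>\<^sup>+u. ennreal (u * sqrt (\<alpha> + u\<^sup>2 * c)) * indicator {0..1} u \<partial>lborel) =
    ennreal ((sqrt (\<alpha> + c) ^ 3 - sqrt \<alpha> ^ 3) / (3 * c))"
proof -
  have pos: "\<alpha> + u\<^sup>2 * c > 0" for u
    using assms by (simp add: add_pos_nonneg)
  have "(\<integral>\<^sup>+u. ennreal (u * sqrt (\<alpha> + u\<^sup>2 * c)) * indicator {0..1} u \<partial>lborel) =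
      ennreal (sqrt (\<alpha> + 1\<^sup>2 * c) ^ 3 / (3 * c) - sqrt (\<alpha> + 0\<^sup>2 * c) ^ 3 / (3 * c))"
  proof (rule nn_integral_FTC_Icc)
    fix u :: real assume "u \<in> {0..1}"
    show "((\<lambda>u. sqrt (\<alpha> + u\<^sup>2 * c) ^ 3 / (3 * c)) has_real_derivative u * sqrt (\<alpha> + u\<^sup>2 * c)) (at u)"
      using assms pos[of u]
      by (auto intro!: derivative_eq_intros simp: field_simps power2_eq_square)
    show "0 \<le> u * sqrt (\<alpha> + u\<^sup>2 * c)"
      using \<open>u \<in> {0..1}\<close> pos[of u] by simp
  qed auto
  then show ?thesis
    by (simp add: diff_divide_distrib)
qed

text \<open>The cone \<open>0 \<le> r \<le> q \<le> p\<close> is parametrised by \<open>q = p u\<close>, \<open>r = p u w\<close> with \<open>u, w \<in> [0, 1]\<close>.\<close>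
lemma nn_integral_cone:
  fixes \<alpha> \<beta> \<gamma> :: real
  assumes pos: "\<alpha> > 0" "\<beta> > 0" "\<gamma> > 0"
  shows "(\<integral>\<^sup>+p. \<integral>\<^sup>+q. \<integral>\<^sup>+r. ennreal (sqrt (\<alpha> * p\<^sup>2 + \<beta> * q\<^sup>2 + \<gamma> * r\<^sup>2) * (max 0 (1 - p)) ^ 3) *
        indicator {0..q} r * indicator {..p} q \<partial>lborel \<partial>lborel \<partial>lborel) =
    ennreal (1 / 140) * (\<integral>\<^sup>+w. ennreal ((sqrt (\<alpha> + (\<beta> + \<gamma> * w\<^sup>2)) ^ 3 - sqrt \<alpha> ^ 3) / (3 * (\<beta> + \<gamma> * w\<^sup>2))) *
        indicator {0..1} w \<partial>lborel)"
proof -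
  let ?g = "\<lambda>p q r. ennreal (sqrt (\<alpha> * p\<^sup>2 + \<beta> * q\<^sup>2 + \<gamma> * r\<^sup>2) * (max 0 (1 - p)) ^ 3)"
  let ?I = "\<lambda>w. indicator {0..1::real} w :: ennreal"
  let ?h = "\<lambda>u w. ennreal (u * sqrt (\<alpha> + u\<^sup>2 * (\<beta> + \<gamma> * w\<^sup>2))) * ?I u * ?I w"
  \<comment> \<open>At \<open>p\<close> equal to 0 or 1 the closed indicator \<open>?I p\<close> is
    1 although \<open>p\<close> is outside the open interval where the substitution is made; both
    values form null sets.\<close>
  have slice: "(\<integral>\<^sup>+q. \<integral>\<^sup>+r. ?g p q r * indicator {0..q} r * indicator {..p} q \<partial>lborel \<partial>lborel) =
      ennreal (p ^ 3 * (1 - p) ^ 3) * ?I p * (\<integral>\<^sup>+u. \<integral>\<^sup>+w. ?h u w \<partial>lborel \<partial>lborel)"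
    (is "?L = _") if "p \<noteq> 0" "p \<noteq> 1" for p
  proof (cases "0 < p \<and> p < 1")
    case True
    have "?L = ennreal p * (\<integral>\<^sup>+u. \<integral>\<^sup>+r. ?g p (p * u) r * indicator {0..p * u} r * indicator {..p} (p * u) \<partial>lborel \<partial>lborel)"
      using True by (subst nn_integral_real_affine[where c = p and t = 0]) auto
    also have "\<dots> = ennreal p * (\<integral>\<^sup>+u. ennreal (p ^ 2 * (1 - p) ^ 3) * (\<integral>\<^sup>+w. ?h u w \<partial>lborel) \<partial>lborel)"
    proof (intro arg_cong[where f = "\<lambda>x. ennreal p * x"] nn_integral_cong_AE)
      have "(\<integral>\<^sup>+r. ?g p (p * u) r * indicator {0..p * u} r * indicator {..p} (p * u) \<partial>lborel) =
          ennreal (p ^ 2 * (1 - p) ^ 3) * (\<integral>\<^sup>+w. ?h u w \<partial>lborel)" (is "?L' = _") if "u \<noteq> 0" for u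
      proof (cases "0 < u \<and> u \<le> 1")
        case u: True
        have scale: "sqrt (\<alpha> * p\<^sup>2 + \<beta> * (p * u)\<^sup>2 + \<gamma> * (p * u * w)\<^sup>2) = p * sqrt (\<alpha> + u\<^sup>2 * (\<beta> + \<gamma> * w\<^sup>2))" for w
        proof -
          have "\<alpha> * p\<^sup>2 + \<beta> * (p * u)\<^sup>2 + \<gamma> * (p * u * w)\<^sup>2 = p\<^sup>2 * (\<alpha> + u\<^sup>2 * (\<beta> + \<gamma> * w\<^sup>2))"
            by (simp add: power_mult_distrib algebra_simps)
          then show ?thesis
            using True by (simp add: real_sqrt_mult)
        qed
        have "?L' = ennreal (p * u) * (\<integral>\<^sup>+w. ?g p (p * u) (p * u * w) * indicator {0..p * u} (p * u * w) * indicator {..p} (p * u) \<partial>lborel)"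
          using True u by (subst nn_integral_real_affine[where c = "p * u" and t = 0]) auto
        \<comment> \<open>The division by \<open>u\<close> offsets the factor \<open>u\<close> built
          into \<open>?h\<close>; together with the Jacobian p u it leaves p^2 (1 - p)^3, free of
          \<open>u\<close>.\<close>
        also have "\<dots> = ennreal (p * u) * (\<integral>\<^sup>+w. ennreal (p * (1 - p) ^ 3 / u) * ?h u w \<partial>lborel)"
        proof (intro arg_cong[where f = "\<lambda>x. ennreal (p * u) * x"] nn_integral_cong)
          fix w
          have ind: "indicator {0..p * u} (p * u * w) = ?I w" "indicator {..p} (p * u) = (1 :: ennreal)" "?I u = 1"
            using True u by (auto simp: indicator_def zero_le_mult_iff mult_le_0_iff)
          show "?g p (p * u) (p * u * w) * indicator {0..p * u} (p * u * w) * indicator {..p} (p * u) =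
              ennreal (p * (1 - p) ^ 3 / u) * ?h u w"
          proof -
            let ?Z = "sqrt (\<alpha> + u\<^sup>2 * (\<beta> + \<gamma> * w\<^sup>2))"
            have "ennreal (p * ?Z * max 0 (1 - p) ^ 3) = ennreal (p * (1 - p) ^ 3 / u * (u * ?Z))"
              using True u by (simp add: ac_simps)
            also have "\<dots> = ennreal (p * (1 - p) ^ 3 / u) * ennreal (u * ?Z)"
              using True u by (intro ennreal_mult') simp
            finally show ?thesis
              unfolding scale ind by (simp only: mult_1_right mult.assoc)
          qed
        qed
        also have "\<dots> = ennreal (p * u) * (ennreal (p * (1 - p) ^ 3 / u) * (\<integral>\<^sup>+w. ?h u w \<partial>lborel))"
          by (subst nn_integral_cmult) auto
        also have "\<dots> = ennreal (p ^ 2 * (1 - p) ^ 3) * (\<integral>\<^sup>+w. ?h u w \<partial>lborel)"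
          using True u by (simp add: mult.assoc[symmetric] ennreal_mult'[symmetric] power2_eq_square)
        finally show ?thesis .
      next
        case u: False
        have zero: "X * indicator {0..p * u} r * indicator {..p} (p * u) = (0 :: ennreal)" for r X
        proof -
          have "\<not> (0 \<le> r \<and> r \<le> p * u \<and> p * u \<le> p)"
          proof
            assume a: "0 \<le> r \<and> r \<le> p * u \<and> p * u \<le> p"
            then have "0 \<le> p * u" "p * u \<le> p * 1"
              by auto
            with True have "0 \<le> u" "u \<le> 1"
              by (auto simp: zero_le_mult_iff)
            with u \<open>u \<noteq> 0\<close> show False
              by auto
          qed
          then show ?thesis
            by (auto simp: indicator_def)
        qed
        have "?I u = 0"
          using u \<open>u \<noteq> 0\<close> by (auto simp: indicator_def)
        then show ?thesis
          unfolding zero by simp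
      qed
      then show "AE u in lborel. (\<integral>\<^sup>+r. ?g p (p * u) r * indicator {0..p * u} r * indicator {..p} (p * u) \<partial>lborel) =
          ennreal (p ^ 2 * (1 - p) ^ 3) * (\<integral>\<^sup>+w. ?h u w \<partial>lborel)"
        using AE_lborel_singleton[of 0] by (auto elim!: eventually_mono)
    qed
    also have "\<dots> = ennreal p * (ennreal (p ^ 2 * (1 - p) ^ 3) * (\<integral>\<^sup>+u. \<integral>\<^sup>+w. ?h u w \<partial>lborel \<partial>lborel))"
      by (subst nn_integral_cmult) auto
    also have "\<dots> = ennreal (p ^ 3 * (1 - p) ^ 3) * ?I p * (\<integral>\<^sup>+u. \<integral>\<^sup>+w. ?h u w \<partial>lborel \<partial>lborel)"
    proof -
      have "ennreal p * ennreal (p ^ 2 * (1 - p) ^ 3) = ennreal (p ^ 3 * (1 - p) ^ 3)"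
        using True by (simp add: ennreal_mult'[symmetric] power3_eq_cube power2_eq_square mult.assoc)
      then show ?thesis
        using True by (simp add: mult.assoc[symmetric])
    qed
    finally show ?thesis .
  next
    case False
    have zero: "?g p q r * indicator {0..q} r * indicator {..p} q = 0" for q r
      using False that by (auto simp: indicator_def max_def)
    have "?I p = 0"
      using False that by (auto simp: indicator_def)
    then show ?thesis
      unfolding zero by simp
  qed
  have "(\<integral>\<^sup>+p. \<integral>\<^sup>+q. \<integral>\<^sup>+r. ?g p q r * indicator {0..q} r * indicator {..p} q \<partial>lborel \<partial>lborel \<partial>lborel) =
      (\<integral>\<^sup>+p. ennreal (p ^ 3 * (1 - p) ^ 3) * ?I p * (\<integral>\<^sup>+u. \<integral>\<^sup>+w. ?h u w \<partial>lborel \<partial>lborel) \<partial>lborel)"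
    using AE_lborel_singleton[of 0] AE_lborel_singleton[of 1]
    by (intro nn_integral_cong_AE) (auto simp: slice elim!: eventually_elim2)
  also have "\<dots> = ennreal (1 / 140) * (\<integral>\<^sup>+u. \<integral>\<^sup>+w. ?h u w \<partial>lborel \<partial>lborel)"
    by (subst nn_integral_multc) (auto simp: nn_integral_weight)
  \<comment> \<open>After the exchange the inner integral over \<open>u\<close> is elementary, and
    only the integral over \<open>w\<close> remains.\<close>
  also have "(\<integral>\<^sup>+u. \<integral>\<^sup>+w. ?h u w \<partial>lborel \<partial>lborel) = (\<integral>\<^sup>+w. \<integral>\<^sup>+u. ?h u w \<partial>lborel \<partial>lborel)"
    by (rule lborel_pair.Fubini') measurable
  also have "\<dots> = (\<integral>\<^sup>+w. ennreal ((sqrt (\<alpha> + (\<beta> + \<gamma> * w\<^sup>2)) ^ 3 - sqrt \<alpha> ^ 3) / (3 * (\<beta> + \<gamma> * w\<^sup>2))) * ?I w \<partial>lborel)"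
  proof (rule nn_integral_cong)
    fix w
    have "\<beta> + \<gamma> * w\<^sup>2 > 0"
      using pos by (simp add: add_pos_nonneg)
    then show "(\<integral>\<^sup>+u. ?h u w \<partial>lborel) =
        ennreal ((sqrt (\<alpha> + (\<beta> + \<gamma> * w\<^sup>2)) ^ 3 - sqrt \<alpha> ^ 3) / (3 * (\<beta> + \<gamma> * w\<^sup>2))) * ?I w"
      using pos(1) by (subst nn_integral_multc) (auto simp: nn_integral_radial)
  qed
  finally show ?thesis .
qed

section \<open>Integrals over the faces of the cuboctahedron\<close>

text \<open>These are the three building blocks of (3 + w^2) S / W for W = 1 + w^2 or W = 1 + 3 w^2.
  The parameter \<open>k\<close> fits 3 + (1 + k^2) w^2 to 3 W: k = sqrt 2 for the square and k = 2
  sqrt 2 for the triangle.\<close>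

lemma has_real_derivative_sqrt_primitives:
  fixes w k :: real
  defines "S \<equiv> \<lambda>w. sqrt (3 + w\<^sup>2)"
  shows "((\<lambda>w. w * S w / 2 + 3 / 2 * ln (w + S w)) has_real_derivative S w) (at w)"
    and "((\<lambda>w. ln (w + S w)) has_real_derivative 1 / S w) (at w)"
    and "((\<lambda>w. arctan (k * w / S w)) has_real_derivative 3 * k / (S w * (3 + (1 + k\<^sup>2) * w\<^sup>2))) (at w)"
proof -
  have pos: "0 < 3 + w\<^sup>2"
    by (simp add: add_pos_nonneg)
  have S: "S w > 0" "S w * S w = 3 + w\<^sup>2"
    using pos by (simp_all add: S_def)
  have dS: "(S has_real_derivative w / S w) (at w)"
    unfolding S_def using pos by (auto intro!: derivative_eq_intros simp: field_simps)
  \<comment> \<open>The left side is |w|, so w + S w stays positive for negative \<open>w\<close>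
    too and the logarithm is differentiable everywhere.\<close>
  have "sqrt (w\<^sup>2) < S w"
    unfolding S_def by (intro real_sqrt_less_mono) simp
  then have arg: "w + S w > 0"
    by simp
  have "((\<lambda>w. ln (w + S w)) has_real_derivative (1 + w / S w) / (w + S w)) (at w)"
    using arg by (auto intro!: derivative_eq_intros dS)
  also have "(1 + w / S w) / (w + S w) = 1 / S w"
  proof -
    have "1 + w / S w = (w + S w) / S w"
      using S(1) by (simp add: field_simps)
    then show ?thesis
      using arg by simp
  qed
  finally show dL: "((\<lambda>w. ln (w + S w)) has_real_derivative 1 / S w) (at w)" .
  have "((\<lambda>w. w * S w / 2 + 3 / 2 * ln (w + S w)) has_real_derivative
      (1 * S w + w / S w * w) / 2 + 3 / 2 * (1 / S w)) (at w)"
    by (intro DERIV_add DERIV_cdivide DERIV_mult DERIV_ident dS DERIV_cmult dL)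
  also have "(1 * S w + w / S w * w) / 2 + 3 / 2 * (1 / S w) = S w"
  proof -
    have "((1 * S w + w / S w * w) / 2 + 3 / 2 * (1 / S w)) * S w = (S w * S w + w\<^sup>2 + 3) / 2"
      using S(1) by (simp add: field_simps power2_eq_square)
    also have "\<dots> = S w * S w"
      using S(2) by simp
    finally show ?thesis
      using S(1) by simp
  qed
  finally show "((\<lambda>w. w * S w / 2 + 3 / 2 * ln (w + S w)) has_real_derivative S w) (at w)" .
  have "((\<lambda>w. arctan (k * w / S w)) has_real_derivative
      inverse (1 + (k * w / S w)\<^sup>2) * ((k * 1 * S w - k * w * (w / S w)) / (S w * S w))) (at w)"
    using S(1)
    by (intro DERIV_chain2[OF DERIV_arctan DERIV_divide[OF DERIV_cmult[OF DERIV_ident] dS]]) simp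
  also have "inverse (1 + (k * w / S w)\<^sup>2) * ((k * 1 * S w - k * w * (w / S w)) / (S w * S w)) =
      3 * k / (S w * (3 + (1 + k\<^sup>2) * w\<^sup>2))"
  proof -
    have "k * S w - k * w * (w / S w) = k * (S w * S w - w\<^sup>2) / S w"
      using S(1) by (simp add: field_simps power2_eq_square)
    then have num: "k * S w - k * w * (w / S w) = 3 * k / S w"
      using S(2) by simp
    have "S w * S w * (1 + (k * w / S w)\<^sup>2) = S w * S w + k\<^sup>2 * w\<^sup>2"
      using S(1) by (simp add: field_simps power2_eq_square)
    then have den: "S w * S w * (1 + (k * w / S w)\<^sup>2) = 3 + (1 + k\<^sup>2) * w\<^sup>2"
      using S(2) by (simp add: algebra_simps)
    have "inverse (1 + (k * w / S w)\<^sup>2) * ((k * 1 * S w - k * w * (w / S w)) / (S w * S w)) =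
        (k * S w - k * w * (w / S w)) / (S w * S w * (1 + (k * w / S w)\<^sup>2))"
      by (simp add: divide_inverse)
    then show ?thesis
      unfolding den num by simp
  qed
  finally show "((\<lambda>w. arctan (k * w / S w)) has_real_derivative 3 * k / (S w * (3 + (1 + k\<^sup>2) * w\<^sup>2))) (at w)" .
qed

text \<open>Partial fractions in v = w^2: after writing (3 + v) s as (3 + v)^2 / s, the polynomial
  (3 + v)^2 is divided by \<open>W\<close>, and \<open>eq\<close> records the quotient and the
  remainder \<open>c\<close>.\<close>

lemma sqrt_sum_eq:
  fixes a b c s v W :: real
  assumes s: "s > 0" "s * s = 3 + v" and W: "W \<noteq> 0" and eq: "a * (3 + v) * W + b * W + c = (3 + v)\<^sup>2"
  shows "a * s + b * (1 / s) + c / (s * W) = (3 + v) * s / W"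
proof -
  have "a * s + b * (1 / s) + c / (s * W) = (a * (s * s) * W + b * W + c) / (s * W)"
    using s(1) W by (simp add: add_divide_distrib)
  also have "\<dots> = (3 + v) * (s * s) / (s * W)"
    using eq unfolding s(2) by (simp add: power2_eq_square)
  finally show ?thesis
    using s(1) by simp
qed

lemma sqrt_cube_diff_nonneg: "0 \<le> a \<Longrightarrow> 0 \<le> b \<Longrightarrow> 0 \<le> sqrt (a + b) ^ 3 - sqrt a ^ 3"
  by (simp add: power_mono)

text \<open>The radicand is \<alpha> + \<beta> + \<gamma> w^2, the squared length of a point on the
  half edge common to both faces.\<close>

lemma sqrt_cube_half: "sqrt (3 / 2 + w\<^sup>2 / 2) ^ 3 = (3 + w\<^sup>2) * sqrt (3 + w\<^sup>2) / (2 * sqrt 2)"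
proof -
  have "3 / 2 + w\<^sup>2 / 2 = (3 + w\<^sup>2) / 2"
    by simp
  then have eq: "sqrt (3 / 2 + w\<^sup>2 / 2) = sqrt (3 + w\<^sup>2) / sqrt 2"
    by (simp only: real_sqrt_divide)
  have "sqrt (3 + w\<^sup>2) ^ 3 = (3 + w\<^sup>2) * sqrt (3 + w\<^sup>2)" "sqrt 2 ^ 3 = 2 * sqrt 2"
    by (simp_all add: power3_eq_cube)
  then show ?thesis
    unfolding eq power_divide by simp
qed

lemma arctan_half_sqrt2: "arctan (sqrt 2 / 2) = pi / 2 - arctan (sqrt 2)"
proof -
  have eq: "sqrt 2 / 2 = inverse (sqrt 2)"
    by (simp add: field_simps)
  show ?thesis
    unfolding eq by (subst arctan_inverse) simp_all
qed

lemma arctan_sqrt3: "arctan (sqrt 3) = pi / 3"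
proof (rule arctan_unique)
  show "- (pi / 2) < pi / 3"
    using pi_gt_zero by linarith
qed (simp_all add: tan_60)

lemma nn_integral_square_face:
  "(\<integral>\<^sup>+w. ennreal ((sqrt (1 + (1/2 + 1/2 * w\<^sup>2)) ^ 3 - sqrt 1 ^ 3) / (3 * (1/2 + 1/2 * w\<^sup>2))) *
      indicator {0..1} w \<partial>lborel) =
    ennreal ((1 + 7 / 4 * ln 3) / (3 * sqrt 2) + pi / 6 - 2 / 3 * arctan (sqrt 2))"
proof -
  define S where "S w = sqrt (3 + w\<^sup>2)" for w :: real
  \<comment> \<open>The coefficients 1, 2, 4 come from (3+v)^2 = (3+v)(1+v) + 2(1+v) + 4. The
    arctangent has derivative sqrt 2 / (S W), whence 4 / sqrt 2. The subtracted term integrates the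
    part with sqrt 1 ^ 3.\<close>
  define F where "F = (\<lambda>w. 1 / (3 * sqrt 2) * ((w * S w / 2 + 3 / 2 * ln (w + S w)) + 2 * ln (w + S w) +
      4 / sqrt 2 * arctan (sqrt 2 * w / S w)) - 2 / 3 * arctan w)"
  note prim = has_real_derivative_sqrt_primitives[folded S_def]
  have "(\<integral>\<^sup>+w. ennreal ((sqrt (1 + (1/2 + 1/2 * w\<^sup>2)) ^ 3 - sqrt 1 ^ 3) / (3 * (1/2 + 1/2 * w\<^sup>2))) *
      indicator {0..1} w \<partial>lborel) = ennreal (F 1 - F 0)"
  proof (rule nn_integral_FTC_Icc)
    fix w :: real
    have S: "S w > 0" "S w * S w = 3 + w\<^sup>2"
      by (simp_all add: S_def add_pos_nonneg)
    have w: "1 + w\<^sup>2 \<noteq> 0"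
      by (metis add_pos_nonneg less_irrefl zero_le_power2 zero_less_one)
    have "(F has_real_derivative 1 / (3 * sqrt 2) * (S w + 2 * (1 / S w) +
        4 / sqrt 2 * (3 * sqrt 2 / (S w * (3 + (1 + (sqrt 2)\<^sup>2) * w\<^sup>2)))) - 2 / 3 * (1 / (1 + w\<^sup>2))) (at w)"
      unfolding F_def
      by (intro DERIV_diff DERIV_add DERIV_cmult prim) (simp add: DERIV_arctan flip: inverse_eq_divide)
    also have "4 / sqrt 2 * (3 * sqrt 2 / (S w * (3 + (1 + (sqrt 2)\<^sup>2) * w\<^sup>2))) = 4 / (S w * (1 + w\<^sup>2))"
    proof -
      have "3 + (1 + (sqrt 2)\<^sup>2) * w\<^sup>2 = 3 * (1 + w\<^sup>2)"
        by simp
      moreover have "4 / sqrt 2 * (3 * sqrt 2 / (S w * (3 * W))) = 4 / (S w * W)" for W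
        by simp
      ultimately show ?thesis
        by (simp only:)
    qed
    also have "S w + 2 * (1 / S w) + 4 / (S w * (1 + w\<^sup>2)) = (3 + w\<^sup>2) * S w / (1 + w\<^sup>2)"
    proof -
      have "1 * (3 + w\<^sup>2) * (1 + w\<^sup>2) + 2 * (1 + w\<^sup>2) + 4 = (3 + w\<^sup>2)\<^sup>2"
        by (simp add: algebra_simps power2_eq_square)
      from sqrt_sum_eq[OF S w this] show ?thesis
        by simp
    qed
    also have "1 / (3 * sqrt 2) * ((3 + w\<^sup>2) * S w / (1 + w\<^sup>2)) - 2 / 3 * (1 / (1 + w\<^sup>2)) =
        ((3 + w\<^sup>2) * S w / (2 * sqrt 2) - 1) / (3 * (1/2 + 1/2 * w\<^sup>2))"
    proof -
      have eq: "3 * (1/2 + 1/2 * w\<^sup>2) = 3 / 2 * (1 + w\<^sup>2)"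
        by simp
      have "1 / (3 * sqrt 2) * (X / W) - 2 / 3 * (1 / W) = (X / (2 * sqrt 2) - 1) / (3 / 2 * W)"
        if "W \<noteq> 0" for X W
        using that by (simp add: field_simps)
      from this[OF w] show ?thesis
        unfolding eq .
    qed
    also have "(3 + w\<^sup>2) * S w / (2 * sqrt 2) - 1 = sqrt (1 + (1/2 + 1/2 * w\<^sup>2)) ^ 3 - sqrt 1 ^ 3"
      using sqrt_cube_half[of w] by (simp add: S_def)
    finally show "(F has_real_derivative
        (sqrt (1 + (1/2 + 1/2 * w\<^sup>2)) ^ 3 - sqrt 1 ^ 3) / (3 * (1/2 + 1/2 * w\<^sup>2))) (at w)" .
    show "0 \<le> (sqrt (1 + (1/2 + 1/2 * w\<^sup>2)) ^ 3 - sqrt 1 ^ 3) / (3 * (1/2 + 1/2 * w\<^sup>2))"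
      by (intro divide_nonneg_nonneg sqrt_cube_diff_nonneg) simp_all
  qed auto
  also have "F 1 - F 0 = (1 + 7 / 4 * ln 3) / (3 * sqrt 2) + pi / 6 - 2 / 3 * arctan (sqrt 2)"
  proof -
    have S01: "S 1 = 2" "S 0 = sqrt 3"
      by (simp_all add: S_def)
    have "F 1 = 1 / (3 * sqrt 2) * (1 + 7 / 2 * ln 3 + 4 / sqrt 2 * (pi / 2 - arctan (sqrt 2))) - 2 / 3 * (pi / 4)"
      by (simp add: F_def S01 arctan_half_sqrt2 arctan_one)
    moreover have "F 0 = 1 / (3 * sqrt 2) * (7 / 2 * (ln 3 / 2))"
      by (simp add: F_def S01 ln_sqrt)
    moreover have "1 / (3 * sqrt 2) * (1 + 7 / 2 * ln 3 + 4 / sqrt 2 * X) = 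
        1 / (3 * sqrt 2) * (1 + 7 / 2 * ln 3) + 2 / 3 * X" for X
      by (simp add: algebra_simps)
    ultimately have "F 1 - F 0 = 1 / (3 * sqrt 2) * (1 + 7 / 2 * ln 3) + 2 / 3 * (pi / 2 - arctan (sqrt 2)) - 2 / 3 * (pi / 4) - 1 / (3 * sqrt 2) * (7 / 2 * (ln 3 / 2))"
      by (simp only:)
    also have "\<dots> = (1 + 7 / 4 * ln 3) / (3 * sqrt 2) + pi / 6 - 2 / 3 * arctan (sqrt 2)"
      by (simp add: field_simps)
    finally show ?thesis .
  qed
  finally show ?thesis .
qed

lemma nn_integral_triangle_face:
  "(\<integral>\<^sup>+w. ennreal ((sqrt (4/3 + (1/6 + 1/2 * w\<^sup>2)) ^ 3 - sqrt (4/3) ^ 3) / (3 * (1/6 + 1/2 * w\<^sup>2))) *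
      indicator {0..1} w \<partial>lborel) =
    ennreal ((1 / 3 + 25 / 36 * ln 3) / sqrt 2 + 16 / 9 * arctan (sqrt 2) - 16 / 27 * pi)"
proof -
  define S where "S w = sqrt (3 + w\<^sup>2)" for w :: real
  \<comment> \<open>With W = 1 + 3v the partial fractions have coefficients 1/3, 8/9 and 64/9, the
    last being (3+v)^2 at v = -1/3. The arctangent has derivative 2 sqrt 2 / (S W), whence 32 / (9
    sqrt 2).\<close>
  define F where "F = (\<lambda>w. 1 / sqrt 2 * (1 / 3 * (w * S w / 2 + 3 / 2 * ln (w + S w)) + 8 / 9 * ln (w + S w) +
      32 / (9 * sqrt 2) * arctan ((2 * sqrt 2) * w / S w)) - 16 / 9 * arctan (sqrt 3 * w))"
  note prim = has_real_derivative_sqrt_primitives[folded S_def]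
  have cube: "sqrt (4/3) ^ 3 = 8 / (3 * sqrt 3)"
    by (simp add: real_sqrt_divide power_divide power3_eq_cube)
  have "(\<integral>\<^sup>+w. ennreal ((sqrt (4/3 + (1/6 + 1/2 * w\<^sup>2)) ^ 3 - sqrt (4/3) ^ 3) / (3 * (1/6 + 1/2 * w\<^sup>2))) *
      indicator {0..1} w \<partial>lborel) = ennreal (F 1 - F 0)"
  proof (rule nn_integral_FTC_Icc)
    fix w :: real
    have S: "S w > 0" "S w * S w = 3 + w\<^sup>2"
      by (simp_all add: S_def add_pos_nonneg)
    have "1 + 3 * w\<^sup>2 > 0"
      by (simp add: add_pos_nonneg)
    then have w: "1 + 3 * w\<^sup>2 \<noteq> 0"
      by simp
    have "((\<lambda>w. arctan (sqrt 3 * w)) has_real_derivative sqrt 3 / (1 + 3 * w\<^sup>2)) (at w)"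
      by (auto intro!: derivative_eq_intros simp: power_mult_distrib divide_inverse)
    then have "(F has_real_derivative 1 / sqrt 2 * (1 / 3 * S w + 8 / 9 * (1 / S w) +
        32 / (9 * sqrt 2) * (3 * (2 * sqrt 2) / (S w * (3 + (1 + (2 * sqrt 2)\<^sup>2) * w\<^sup>2)))) -
        16 / 9 * (sqrt 3 / (1 + 3 * w\<^sup>2))) (at w)"
      unfolding F_def by (intro DERIV_diff DERIV_add DERIV_cmult prim)
    also have "32 / (9 * sqrt 2) * (3 * (2 * sqrt 2) / (S w * (3 + (1 + (2 * sqrt 2)\<^sup>2) * w\<^sup>2))) =
        64 / (9 * (S w * (1 + 3 * w\<^sup>2)))"
    proof -
      have "3 + (1 + (2 * sqrt 2)\<^sup>2) * w\<^sup>2 = 3 * (1 + 3 * w\<^sup>2)"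
        by (simp add: power_mult_distrib)
      then show ?thesis
        using w S(1) by simp
    qed
    also have "1 / 3 * S w + 8 / 9 * (1 / S w) + 64 / (9 * (S w * (1 + 3 * w\<^sup>2))) = (3 + w\<^sup>2) * S w / (1 + 3 * w\<^sup>2)"
    proof -
      have "1 / 3 * (3 + w\<^sup>2) * (1 + 3 * w\<^sup>2) + 8 / 9 * (1 + 3 * w\<^sup>2) + 64 / 9 = (3 + w\<^sup>2)\<^sup>2"
        by (simp add: field_simps power2_eq_square)
      from sqrt_sum_eq[OF S w this] show ?thesis
        by simp
    qed
    also have "1 / sqrt 2 * ((3 + w\<^sup>2) * S w / (1 + 3 * w\<^sup>2)) - 16 / 9 * (sqrt 3 / (1 + 3 * w\<^sup>2)) =
        ((3 + w\<^sup>2) * S w / (2 * sqrt 2) - 8 / (3 * sqrt 3)) / (3 * (1/6 + 1/2 * w\<^sup>2))"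
    proof -
      have eq: "8 / (3 * sqrt 3) = 8 / 9 * sqrt 3" "3 * (1/6 + 1/2 * w\<^sup>2) = 1 / 2 * (1 + 3 * w\<^sup>2)"
        by (simp_all add: field_simps)
      have "1 / sqrt 2 * (X / W) - 16 / 9 * (sqrt 3 / W) = (X / (2 * sqrt 2) - 8 / 9 * sqrt 3) / (1 / 2 * W)"
        if "W \<noteq> 0" for X W
        using that by (simp add: field_simps)
      from this[OF w] show ?thesis
        unfolding eq .
    qed
    also have "(3 + w\<^sup>2) * S w / (2 * sqrt 2) - 8 / (3 * sqrt 3) =
        sqrt (4/3 + (1/6 + 1/2 * w\<^sup>2)) ^ 3 - sqrt (4/3) ^ 3"
      using sqrt_cube_half[of w] unfolding cube by (simp add: S_def)
    finally show "(F has_real_derivative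
        (sqrt (4/3 + (1/6 + 1/2 * w\<^sup>2)) ^ 3 - sqrt (4/3) ^ 3) / (3 * (1/6 + 1/2 * w\<^sup>2))) (at w)" .
    show "0 \<le> (sqrt (4/3 + (1/6 + 1/2 * w\<^sup>2)) ^ 3 - sqrt (4/3) ^ 3) / (3 * (1/6 + 1/2 * w\<^sup>2))"
      by (intro divide_nonneg_nonneg sqrt_cube_diff_nonneg) simp_all
  qed auto
  also have "F 1 - F 0 = (1 / 3 + 25 / 36 * ln 3) / sqrt 2 + 16 / 9 * arctan (sqrt 2) - 16 / 27 * pi"
  proof -
    have S01: "S 1 = 2" "S 0 = sqrt 3"
      by (simp_all add: S_def)
    have "F 1 = 1 / sqrt 2 * (1 / 3 * (1 + 3 / 2 * ln 3) + 8 / 9 * ln 3 + 32 / (9 * sqrt 2) * arctan (sqrt 2)) - 16 / 9 * (pi / 3)"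
      by (simp add: F_def S01 arctan_sqrt3)
    moreover have "F 0 = 1 / sqrt 2 * (25 / 18 * (ln 3 / 2))"
      by (simp add: F_def S01 ln_sqrt)
    moreover have "1 / sqrt 2 * (1 / 3 * (1 + 3 / 2 * ln 3) + 8 / 9 * ln 3 + 32 / (9 * sqrt 2) * X) =
        1 / sqrt 2 * (1 / 3 + 25 / 18 * ln 3) + 16 / 9 * X" for X
      by (simp add: algebra_simps)
    ultimately have "F 1 - F 0 = 1 / sqrt 2 * (1 / 3 + 25 / 18 * ln 3) + 16 / 9 * arctan (sqrt 2) - 16 / 9 * (pi / 3) - 1 / sqrt 2 * (25 / 18 * (ln 3 / 2))"
      by (simp only:)
    also have "\<dots> = (1 / 3 + 25 / 36 * ln 3) / sqrt 2 + 16 / 9 * arctan (sqrt 2) - 16 / 27 * pi"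
      by (simp add: field_simps)
    finally show ?thesis .
  qed
  finally show ?thesis .
qed

section \<open>The mean distance\<close>

text \<open>Common reduction for both face types. The numbers \<alpha>, \<beta>, \<gamma> are the
  squared lengths of the orthogonal columns of \<open>A\<close>. The gauge formula is asked for on
  the cone only, since the indicator of \<open>D\<close> removes all other points.\<close>

lemma nn_integral_cone_chart:
  fixes A :: "real^3^3"
  assumes [measurable]: "D \<in> sets borel" and det: "det A \<noteq> 0" and pos: "\<alpha> > 0" "\<beta> > 0" "\<gamma> > 0"
    and norm: "\<And>p q r. norm (A *v vector [p, q, r]) = sqrt (\<alpha> * p\<^sup>2 + \<beta> * q\<^sup>2 + \<gamma> * r\<^sup>2)"
    and D: "\<And>p q r. A *v vector [p, q, r] \<in> D \<longleftrightarrow> 0 \<le> r \<and> r \<le> q \<and> q \<le> p"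
    and gauge: "\<And>p q r. 0 \<le> r \<Longrightarrow> r \<le> q \<Longrightarrow> q \<le> p \<Longrightarrow> cubocta_norm (A *v vector [p, q, r]) = p"
  shows "(\<integral>\<^sup>+z. ennreal (norm z * (max 0 (1 - cubocta_norm z)) ^ 3) * indicator D z \<partial>lborel) =
    ennreal (\<bar>det A\<bar> / 140) * (\<integral>\<^sup>+w. ennreal ((sqrt (\<alpha> + (\<beta> + \<gamma> * w\<^sup>2)) ^ 3 - sqrt \<alpha> ^ 3) /
      (3 * (\<beta> + \<gamma> * w\<^sup>2))) * indicator {0..1} w \<partial>lborel)"
proof -
  let ?g = "\<lambda>z. ennreal (norm z * (max 0 (1 - cubocta_norm z)) ^ 3) * indicator D z"
  have [measurable]: "(*v) A \<in> borel_measurable borel"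
    by (intro borel_measurable_continuous_onI linear_continuous_on) (simp add: linear_linear)
  have chart: "?g (A *v vector [p, q, r]) = ennreal (sqrt (\<alpha> * p\<^sup>2 + \<beta> * q\<^sup>2 + \<gamma> * r\<^sup>2) * (max 0 (1 - p)) ^ 3) *
      indicator {0..q} r * indicator {..p} q" for p q r
    by (auto simp: norm D gauge indicator_def)
  have "(\<integral>\<^sup>+z. ?g z \<partial>lborel) = ennreal \<bar>det A\<bar> * (\<integral>\<^sup>+z. ?g (A *v z) \<partial>lborel)"
    using det by (subst nn_integral_lborel_affine[where A = A and a = 0]) simp_all
  also have "(\<integral>\<^sup>+z. ?g (A *v z) \<partial>lborel) =
      (\<integral>\<^sup>+p. \<integral>\<^sup>+q. \<integral>\<^sup>+r. ?g (A *v vector [p, q, r]) \<partial>lborel \<partial>lborel \<partial>lborel)"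
    by (rule nn_integral_lborel_vector3) measurable
  finally show ?thesis
    unfolding chart nn_integral_cone[OF pos]
    by (simp add: mult.assoc[symmetric] ennreal_mult'[symmetric])
qed

lemma nn_integral_gauge_weight:
  "(\<integral>\<^sup>+z. ennreal (norm z * (max 0 (1 - cubocta_norm z)) ^ 3) \<partial>lborel) =
    48 * (ennreal (1 / 280) * ennreal ((1 + 7 / 4 * ln 3) / (3 * sqrt 2) + pi / 6 - 2 / 3 * arctan (sqrt 2)) +
      ennreal (1 / 420) * ennreal ((1 / 3 + 25 / 36 * ln 3) / sqrt 2 + 16 / 9 * arctan (sqrt 2) - 16 / 27 * pi))"
    (is "_ = 48 * (?A + ?B)")
proof -
  let ?g = "\<lambda>z. ennreal (norm z * (max 0 (1 - cubocta_norm z)) ^ 3)"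
  let ?D = "{x::real^3. x$1 \<ge> x$2 \<and> x$2 \<ge> x$3 \<and> x$3 \<ge> 0}"
  \<comment> \<open>On \<open>?D\<close> the gauge is the larger of x and (x + y + z)/2, the forms
    of a square and a triangular face; they agree where y + z = x.\<close>
  define DA DB where D_def: "DA = ?D \<inter> {x. x$2 + x$3 \<le> x$1}" "DB = ?D \<inter> {x. x$2 + x$3 \<ge> x$1}"
  have [measurable]: "DA \<in> sets borel" "DB \<in> sets borel"
    unfolding D_def by measurable
  have "(\<integral>\<^sup>+z. ?g z \<partial>lborel) = 48 * (\<integral>\<^sup>+z. ?g z * indicator ?D z \<partial>lborel)"
  proof (rule nn_integral_octahedral_symmetry)
    show "?g (vector [-x, y, z]) = ?g (vector [x, y, z])" "?g (vector [y, z, x]) = ?g (vector [x, y, z])"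
      "?g (vector [x, z, y]) = ?g (vector [x, y, z])" for x y z
    proof -
      have "\<bar>- x - y - z\<bar> = \<bar>x + y + z\<bar>" "\<bar>y + x - z\<bar> = \<bar>z - x - y\<bar>" "\<bar>z + x - y\<bar> = \<bar>y - x - z\<bar>"
        "\<bar>- x + y + z\<bar> = \<bar>x - y - z\<bar>"
        by (auto simp: abs_if)
      then have "cubocta_norm (vector [-x, y, z]) = cubocta_norm (vector [x, y, z])"
        by (simp add: cubocta_norm_def)
      moreover have "cubocta_norm (vector [y, z, x]) = cubocta_norm (vector [x, y, z])"
        "cubocta_norm (vector [x, z, y]) = cubocta_norm (vector [x, y, z])"
        by (simp_all add: cubocta_norm_def algebra_simps)
      moreover have "norm (vector [-x, y, z] :: real^3) = norm (vector [x, y, z] :: real^3)"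
        "norm (vector [y, z, x] :: real^3) = norm (vector [x, y, z] :: real^3)"
        "norm (vector [x, z, y] :: real^3) = norm (vector [x, y, z] :: real^3)"
        by (simp_all add: norm_eq_sqrt_inner inner_vec_def sum_3 algebra_simps)
      ultimately show "?g (vector [-x, y, z]) = ?g (vector [x, y, z])" "?g (vector [y, z, x]) = ?g (vector [x, y, z])"
        "?g (vector [x, z, y]) = ?g (vector [x, y, z])"
        by simp_all
    qed
  qed measurable
  also have "(\<integral>\<^sup>+z. ?g z * indicator ?D z \<partial>lborel) = (\<integral>\<^sup>+z. ?g z * indicator DA z + ?g z * indicator DB z \<partial>lborel)"
  proof (rule nn_integral_cong_AE)
    have "AE x::real^3 in lborel. x$1 - x$2 - x$3 \<noteq> 0"
      using AE_hyperplane[of "vector [1, -1, -1] :: real^3"]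
      by (simp add: inner_vec_def sum_3 vec_eq_iff forall_3)
    then show "AE z in lborel. ?g z * indicator ?D z = ?g z * indicator DA z + ?g z * indicator DB z"
      by (rule eventually_mono) (auto simp: D_def indicator_def)
  qed
  also have "\<dots> = (\<integral>\<^sup>+z. ?g z * indicator DA z \<partial>lborel) + (\<integral>\<^sup>+z. ?g z * indicator DB z \<partial>lborel)"
    by (rule nn_integral_add) measurable
  also have "(\<integral>\<^sup>+z. ?g z * indicator DA z \<partial>lborel) = ?A"
  proof -
    \<comment> \<open>Columns: the centre (1,0,0) of the square face, the step to the edge midpoint
      (1,1/2,1/2), and the step from there to the vertex (1,1,0).\<close>
    define A :: "real^3^3" where "A = vector [vector [1, 0, 0], vector [0, 1/2, 1/2], vector [0, 1/2, -1/2]]"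
    have A: "A *v vector [p, q, r] = vector [p, (q + r) / 2, (q - r) / 2]" for p q r
      by (simp add: A_def vec_eq_iff forall_3 matrix_vector_mult_def sum_3 field_simps)
    have det: "det A = - 1 / 2"
      by (simp add: A_def det_3)
    have "(\<integral>\<^sup>+z. ?g z * indicator DA z \<partial>lborel) = ennreal (\<bar>det A\<bar> / 140) *
        (\<integral>\<^sup>+w. ennreal ((sqrt (1 + (1/2 + 1/2 * w\<^sup>2)) ^ 3 - sqrt 1 ^ 3) / (3 * (1/2 + 1/2 * w\<^sup>2))) *
          indicator {0..1} w \<partial>lborel)"
    proof (rule nn_integral_cone_chart)
      fix p q r :: real
      show "norm (A *v vector [p, q, r]) = sqrt (1 * p\<^sup>2 + 1/2 * q\<^sup>2 + 1/2 * r\<^sup>2)"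
        unfolding A norm_eq_sqrt_inner
        by (rule arg_cong[where f = sqrt]) (simp add: inner_vec_def sum_3 power2_eq_square field_simps)
      show "A *v vector [p, q, r] \<in> DA \<longleftrightarrow> 0 \<le> r \<and> r \<le> q \<and> q \<le> p"
        unfolding A D_def by (auto simp: field_simps)
      show "cubocta_norm (A *v vector [p, q, r]) = p" if "0 \<le> r" "r \<le> q" "q \<le> p"
        unfolding A cubocta_norm_def using that by (simp add: field_simps)
    qed (simp_all add: det)
    then show ?thesis
      unfolding nn_integral_square_face by (simp add: det)
  qed
  also have "(\<integral>\<^sup>+z. ?g z * indicator DB z \<partial>lborel) = ?B"
  proof -
    \<comment> \<open>Columns: the centre (2/3,2/3,2/3) of the triangular face, then steps to the
      same midpoint (1,1/2,1/2) and the same vertex (1,1,0).\<close>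
    define A :: "real^3^3" where
      "A = vector [vector [2/3, 1/3, 0], vector [2/3, -1/6, 1/2], vector [2/3, -1/6, -1/2]]"
    have A: "A *v vector [p, q, r] = vector [2/3 * p + q / 3, 2/3 * p - q / 6 + r / 2, 2/3 * p - q / 6 - r / 2]" for p q r
      by (simp add: A_def vec_eq_iff forall_3 matrix_vector_mult_def sum_3 field_simps)
    have det: "det A = 1 / 3"
      by (simp add: A_def det_3)
    have "(\<integral>\<^sup>+z. ?g z * indicator DB z \<partial>lborel) = ennreal (\<bar>det A\<bar> / 140) *
        (\<integral>\<^sup>+w. ennreal ((sqrt (4/3 + (1/6 + 1/2 * w\<^sup>2)) ^ 3 - sqrt (4/3) ^ 3) / (3 * (1/6 + 1/2 * w\<^sup>2))) *
          indicator {0..1} w \<partial>lborel)"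
    proof (rule nn_integral_cone_chart)
      fix p q r :: real
      show "norm (A *v vector [p, q, r]) = sqrt (4/3 * p\<^sup>2 + 1/6 * q\<^sup>2 + 1/2 * r\<^sup>2)"
        unfolding A norm_eq_sqrt_inner
        by (rule arg_cong[where f = sqrt]) (simp add: inner_vec_def sum_3 power2_eq_square field_simps)
      show "A *v vector [p, q, r] \<in> DB \<longleftrightarrow> 0 \<le> r \<and> r \<le> q \<and> q \<le> p"
        unfolding A D_def by (auto simp: field_simps)
      show "cubocta_norm (A *v vector [p, q, r]) = p" if "0 \<le> r" "r \<le> q" "q \<le> p"
        unfolding A cubocta_norm_def using that by (simp add: field_simps)
    qed (simp_all add: det)
    then show ?thesis
      unfolding nn_integral_triangle_face by (simp add: det)
  qed
  finally show ?thesis .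
qed

abbreviation (input) mean_distance_K :: real where
  "mean_distance_K \<equiv>
     sqrt 2 / 7 - 37 * pi / 315 + 4 / 15 * arctan (sqrt 2) + 113 * ln 3 / (210 * sqrt 2)"

lemma distance_integral_K_tetrahedron_value:
  "enn2real (distance_integral K_tetrahedron) = mean_distance_K / 9"
proof -
  define HA where "HA = (1 + 7 / 4 * ln 3) / (3 * sqrt 2) + pi / 6 - 2 / 3 * arctan (sqrt 2)"
  define HB where "HB = (1 / 3 + 25 / 36 * ln 3) / sqrt 2 + 16 / 9 * arctan (sqrt 2) - 16 / 27 * pi"
  have ln3: "ln 3 \<ge> (1::real)"
    using exp_le by (simp add: ln_ge_iff)
  have sqrt2: "sqrt 2 < 3 / 2"
    by (rule real_less_lsqrt) (simp_all add: power2_eq_square)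
  have "sqrt 2 \<le> sqrt 3" "1 \<le> sqrt 2"
    by simp_all
  then have at: "arctan (sqrt 2) \<le> pi / 3" "pi / 4 \<le> arctan (sqrt 2)"
    using arctan_sqrt3 arctan_one arctan_le_iff by metis+
  \<comment> \<open>\<open>ennreal\<close> truncates negative numbers to 0, so the sum below is
    faithful only for nonnegative \<open>HA\<close> and \<open>HB\<close>. Crude bounds suffice: ln
    3 \<ge> 1, sqrt 2 < 3/2, pi < 4 and pi/4 \<le> arctan (sqrt 2) \<le> pi/3.\<close>
  have "HA \<ge> 0"
  proof -
    have "11 / 18 = (1 + 7 / 4) / (3 * (3 / 2 :: real))"
      by simp
    also have "\<dots> \<le> (1 + 7 / 4 * ln 3) / (3 * sqrt 2)"
      using ln3 sqrt2 by (intro frac_le) auto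
    finally show ?thesis
      using at(1) pi_less_4 unfolding HA_def by linarith
  qed
  have "HB \<ge> 0"
  proof -
    have "37 / 54 = (1 / 3 + 25 / 36) / (3 / 2 :: real)"
      by simp
    also have "\<dots> \<le> (1 / 3 + 25 / 36 * ln 3) / sqrt 2"
      using ln3 sqrt2 by (intro frac_le) auto
    finally show ?thesis
      using at(2) pi_less_4 unfolding HB_def by linarith
  qed
  have "distance_integral K_tetrahedron =
      48 * (ennreal (1 / 280) * ennreal HA + ennreal (1 / 420) * ennreal HB) / 3"
    unfolding distance_integral_K_tetrahedron nn_integral_gauge_weight HA_def HB_def ..
  also have "\<dots> = ennreal 48 * ennreal (1 / 280 * HA + 1 / 420 * HB) / ennreal 3"
    using \<open>HA \<ge> 0\<close> \<open>HB \<ge> 0\<close> by (subst ennreal_plus) (auto simp: ennreal_mult'[symmetric])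
  also have "\<dots> = ennreal (48 * (1 / 280 * HA + 1 / 420 * HB) / 3)"
    using \<open>HA \<ge> 0\<close> \<open>HB \<ge> 0\<close>
    by (subst ennreal_mult[symmetric], simp, simp, subst divide_ennreal, simp_all only: divide_ennreal, simp_all)
  finally have "enn2real (distance_integral K_tetrahedron) = 48 * (1 / 280 * HA + 1 / 420 * HB) / 3"
    using \<open>HA \<ge> 0\<close> \<open>HB \<ge> 0\<close> by simp
  \<comment> \<open>Multiplied by 9 this is 18/35 \<open>HA\<close> + 12/35 \<open>HB\<close>; for
    instance the pi terms give 3/35 - 64/315 = -37/315 and the logarithms 3/10 + 5/21 = 113/210,
    over sqrt 2.\<close>
  also have "\<dots> = mean_distance_K / 9"
  proof -
    have sqrt2_sqrt2: "sqrt 2 * (sqrt 2 * x) = 2 * x" for x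
      by (simp flip: mult.assoc)
    show ?thesis
      unfolding HA_def HB_def by (simp add: field_simps sqrt2_sqrt2)
  qed
  finally show ?thesis .
qed

text \<open>The mean is proportional to the ratio \<open>c\<close> of \<open>T\<close> to
  \<open>K_tetrahedron\<close>, and c^3 / 3 is the volume of \<open>T\<close>. Volumes 1/3 and 1
  give the two claims of the theorem.\<close>

lemma expectation_regular_tetrahedron:
  assumes T: "regular_tetrahedron T" and ind: "independent_uniform_points M X Y T"
  shows "prob_space.expectation M (\<lambda>\<omega>. norm (X \<omega> - Y \<omega>)) =
    root 3 (3 * measure lborel T) * mean_distance_K"
proof -
  obtain a c and A :: "real^3^3" where c: "c > 0" and A: "\<And>x. norm (A *v x) = c * norm x"
    and TK: "T = (\<lambda>x. a + A *v x) ` K_tetrahedron"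
    by (rule regular_tetrahedron_similar_K[OF T], rule that)
  obtain V :: "(real^3) set" where "card V = 4" "T = convex hull V"
    using T unfolding regular_tetrahedron_def by blast
  then have T_meas: "T \<in> sets borel"
    by (metis borel_compact card.infinite finite_imp_compact_convex_hull zero_neq_numeral)
  note scale = distance_integral_similarity[OF c A measurable_K_tetrahedron TK T_meas]
  have m: "measure lborel T = c ^ 3 / 3"
    using c by (simp add: measure_def scale(2) enn2real_mult emeasure_K_tetrahedron)
  have "prob_space.expectation M (\<lambda>\<omega>. norm (X \<omega> - Y \<omega>)) =
      enn2real (distance_integral T) / (measure lborel T)\<^sup>2"
    using c by (intro expectation_norm_diff[OF ind T_meas]) (simp add: m)
  also have "\<dots> = c ^ 7 * (mean_distance_K / 9) / (c ^ 3 / 3)\<^sup>2"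
    using c by (simp add: scale(1) m enn2real_mult distance_integral_K_tetrahedron_value)
  also have "\<dots> = c * mean_distance_K"
  proof -
    have "c ^ 7 * (x / 9) / (c ^ 3 / 3)\<^sup>2 = c * x" for x
      using c by (simp add: power_divide field_simps eval_nat_numeral)
    then show ?thesis .
  qed
  also have "c = root 3 (3 * measure lborel T)"
    using c by (simp add: m real_root_power_cancel)
  finally show ?thesis .
qed

theorem mainTheorem2:
  shows "regular_tetrahedron K_tetrahedron \<and> measure lborel K_tetrahedron = 1 / 3 \<and>
    (\<forall>(M :: 'w measure) X Y. independent_uniform_points M X Y K_tetrahedron \<longrightarrow>
       prob_space.expectation M (\<lambda>\<omega>. norm (X \<omega> - Y \<omega>)) =
         sqrt 2 / 7 - 37 * pi / 315 + 4 / 15 * arctan (sqrt 2) + 113 * ln 3 / (210 * sqrt 2)) \<and>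
    (\<forall>T (M :: 'w measure) X Y.
       regular_tetrahedron T \<and> measure lborel T = 1 \<and> independent_uniform_points M X Y T \<longrightarrow>
       prob_space.expectation M (\<lambda>\<omega>. norm (X \<omega> - Y \<omega>)) =
         root 3 3 *
         (sqrt 2 / 7 - 37 * pi / 315 + 4 / 15 * arctan (sqrt 2) + 113 * ln 3 / (210 * sqrt 2)))"
proof (intro conjI allI impI)
  show "regular_tetrahedron K_tetrahedron"
    by (rule regular_K_tetrahedron)
  show "measure lborel K_tetrahedron = 1 / 3"
    by (rule measure_K_tetrahedron)
next
  fix M :: "'w measure" and X Y
  assume "independent_uniform_points M X Y K_tetrahedron"
  from expectation_regular_tetrahedron[OF regular_K_tetrahedron this]
  show "prob_space.expectation M (\<lambda>\<omega>. norm (X \<omega> - Y \<omega>)) = mean_distance_K"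
    by (simp add: measure_K_tetrahedron)
next
  fix T and M :: "'w measure" and X Y
  assume "regular_tetrahedron T \<and> measure lborel T = 1 \<and> independent_uniform_points M X Y T"
  then show "prob_space.expectation M (\<lambda>\<omega>. norm (X \<omega> - Y \<omega>)) = root 3 3 * mean_distance_K"
    using expectation_regular_tetrahedron[of T M X Y] by simp
qed

end
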